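(* Let $S = NA$ be the solvable Lie group with left-invariant Riemannian metric which realizes the symmetric space $SL(3,\mathbb{C})/SU(3)$. Let $\alpha\in[0,\frac{\pi}{2}]$, $H = \cos(\alpha)H_0+\sin(\alpha)H_1$, and $S_H = N\exp(\mathbb{R}H)\subset S$ with the induced metric. Let $X = aV+bW+cZ_0+tH\in T_eS_H$ with $a,b,c\in\mathbb{C}$ and $t\in\mathbb{R}$ be a unit vector, that is, $|a|^2+|b|^2+|c|^2+t^2=1$. Then the Ricci curvature of $X$ is given by $$\mathrm{Ric}^{S_H}(X) = -3+4\sin(\alpha)\left(\sin\left(\alpha-\frac{\pi}{3}\right)|a|^2+\sin\left(\alpha+\frac{\pi}{3}\right)|b|^2+\sin(\alpha)|c|^2\right).$$ In particular, the space $S_H$ has strictly negative Ricci curvature if and only if $\alpha\in[0,\frac{\pi}{3})$; $S_H$ admits directions of vanishing Ricci curvature for $\alpha=\frac{\pi}{3}$ and directions of positive Ricci curvature for $\alpha\in(\frac{\pi}{3},\frac{\pi}{2}]$. In particular, $S_H$ is Einstein if and only if $\alpha=0$. With regards to sectional curvature, for every $\alpha\in(0,\frac{\pi}{2}]$ the hypersurface $S_H$ has both planes of positive and planes of negative sectional curvature, while for $\alpha=0$ the space $S_H$ is a non-positively curved Damek-Ricci space.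
   Context: Ambient space. $\mathfrak{n}$ is the real Lie algebra of strictly upper triangular complex $3\times 3$ matrices, $\mathfrak{a}$ the Lie algebra of real diagonal trace-zero $3\times 3$ matrices, $N, A \subset SL(3,\mathbb{C})$ the corresponding connected Lie groups, and $S = NA$, with Lie algebra $\mathfrak{s} = \mathfrak{n}\oplus\mathfrak{a} = T_eS$. By the Iwasawa decomposition $SL(3,\mathbb{C}) = NA\,SU(3)$, the map $S \to SL(3,\mathbb{C})/SU(3)$, $s \mapsto s\,SU(3)$, is a diffeomorphism. The symmetric metric on $SL(3,\mathbb{C})/SU(3)$ is the $SL(3,\mathbb{C})$-invariant one induced by the inner product $2\,\mathrm{Re}\,\mathrm{Tr}(X_1\bar X_2^\top)$ on $\mathfrak{p}=\{X\in\mathfrak{sl}(3,\mathbb{C}) : \bar X^\top = X\}$. Its pull-back to $S$ is the left-invariant metric given on $\mathfrak{s}$ by $$\langle Y_1 + A_1, Y_2 + A_2\rangle_{\mathfrak{s}} = \mathrm{Re}\,\mathrm{Tr}(Y_1\bar Y_2^\top) + 2\,\mathrm{Tr}(A_1A_2),\qquad Y_i\in\mathfrak{n},\ A_i\in\mathfrak{a}.$$ An orthonormal basis of $\mathfrak{a}$ is $H_0 = \mathrm{diag}(\tfrac12,0,-\tfrac12)$, $H_1 = \mathrm{diag}(\tfrac{1}{2\sqrt3},-\tfrac{1}{\sqrt3},\tfrac{1}{2\sqrt3})$. Hypersurface. $S_H$ is a Lie subgroup with Lie algebra $T_eS_H = \mathfrak{n}\oplus\mathbb{R}H$. With $E_{ij}$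 the elementary $3\times3$ matrices, put $V=E_{12}$, $W=E_{23}$, $Z_0=E_{13}$; then $V,iV,W,iW,Z_0,iZ_0,H$ is an orthonormal basis of $T_eS_H$. Curvature convention. $R(X_1,X_2)X_3 = \nabla_{X_1}\nabla_{X_2}X_3-\nabla_{X_2}\nabla_{X_1}X_3-\nabla_{[X_1,X_2]}X_3$; the sectional curvature of the plane spanned by orthonormal $X_1,X_2$ is $\langle R(X_1,X_2)X_2,X_1\rangle$, and $\mathrm{Ric}^{S_H}(X)=\sum_j\langle R^{S_H}(e_j,X)X,e_j\rangle$ for an orthonormal basis $(e_j)$ of $T_eS_H$. Damek-Ricci space. A Damek-Ricci space is a simply connected solvable Lie group with left-invariant metric whose metric Lie algebra is of the form $\mathfrak{v}\oplus\mathfrak{z}\oplus\mathbb{R}H_0$ (orthogonal direct sum), with $H_0$ a unit vector, $[\mathfrak{v},\mathfrak{v}]\subset\mathfrak{z}$, $[\mathfrak{v},\mathfrak{z}]=[\mathfrak{z},\mathfrak{z}]=\{0\}$; for each $Z\in\mathfrak{z}$ the map $J_Z\in\mathrm{End}(\mathfrak{v})$ defined by $\langle J_Z U_1,U_2\rangle = \langle Z,[U_1,U_2]\rangle$ for all $U_1,U_2\in\mathfrak{v}$ satisfies $J_Z^2 = -\|Z\|^2\,\mathrm{id}_{\mathfrak{v}}$; and $[H_0,U]=\tfrac12U$ for $U\in\mathfrak{v}$, $[H_0,Z]=Z$ for $Z\in\mathfrak{z}$. *)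

theory Defs
  imports "HOL-Analysis.Analysis" "HOL-Algebra.Solvable_Groups"
begin

section \<open>Riemannian geometry of embedded submanifolds\<close>

text \<open>Manifolds are embedded submanifolds \<open>M\<close> of a Euclidean space, tangent spaces are subspaces
  of the ambient space, and functions and vector fields are ambient functions of which only the
  values on \<open>M\<close> matter. A Riemannian metric \<open>g p u v\<close> is only meaningful for \<open>p \<in> M\<close> and
  \<open>u\<close>, \<open>v\<close> tangent to \<open>M\<close> at \<open>p\<close>; the metric induced on a submanifold is therefore the same \<open>g\<close>.\<close>

primrec Ck_on :: "nat \<Rightarrow> 'a::euclidean_space set \<Rightarrow> ('a \<Rightarrow> 'b::euclidean_space) \<Rightarrow> bool" where
  "Ck_on 0 U f \<longleftrightarrow> continuous_on U f"
| "Ck_on (Suc k) U f \<longleftrightarrow>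
     (\<forall>x\<in>U. f differentiable at x) \<and> (\<forall>v. Ck_on k U (\<lambda>x. frechet_derivative f (at x) v))"

definition smooth_on :: "'a::euclidean_space set \<Rightarrow> ('a \<Rightarrow> 'b::euclidean_space) \<Rightarrow> bool" where
  "smooth_on U f \<longleftrightarrow> (\<forall>k. Ck_on k U f)"

definition smooth_within :: "'a::euclidean_space set \<Rightarrow> ('a \<Rightarrow> 'b::euclidean_space) \<Rightarrow> bool" where
  "smooth_within M f \<longleftrightarrow>
     (\<forall>p\<in>M. \<exists>U F. open U \<and> p \<in> U \<and> smooth_on U F \<and> (\<forall>x\<in>U \<inter> M. F x = f x))"

definition curve_in :: "'a::euclidean_space set \<Rightarrow> 'a \<Rightarrow> 'a \<Rightarrow> (real \<Rightarrow> 'a) \<Rightarrow> bool" where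
  "curve_in M p v \<gamma> \<longleftrightarrow>
     (\<exists>\<epsilon>>0. smooth_on {-\<epsilon><..<\<epsilon>} \<gamma> \<and> \<gamma> ` {-\<epsilon><..<\<epsilon>} \<subseteq> M) \<and>
     \<gamma> 0 = p \<and> (\<gamma> has_vector_derivative v) (at 0)"

definition tangent_space :: "'a::euclidean_space set \<Rightarrow> 'a \<Rightarrow> 'a set" where
  "tangent_space M p = {v. \<exists>\<gamma>. curve_in M p v \<gamma>}"

definition vector_field :: "'a::euclidean_space set \<Rightarrow> ('a \<Rightarrow> 'a) \<Rightarrow> bool" where
  "vector_field M X \<longleftrightarrow> smooth_within M X \<and> (\<forall>p\<in>M. X p \<in> tangent_space M p)"

text \<open>The derivative at \<open>p\<close> of a function smooth on \<open>M\<close>, in the direction of a tangent vector \<open>v\<close>.\<close>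

definition deriv_along ::
    "'a::euclidean_space set \<Rightarrow> ('a \<Rightarrow> 'b::euclidean_space) \<Rightarrow> 'a \<Rightarrow> 'a \<Rightarrow> 'b" where
  "deriv_along M f p v =
     (THE d. \<forall>\<gamma>. curve_in M p v \<gamma> \<longrightarrow> ((f \<circ> \<gamma>) has_vector_derivative d) (at 0))"

text \<open>For vector fields tangent to a submanifold of a Euclidean space, the Lie bracket is the
  commutator of the ambient derivatives along \<open>M\<close>; the sign is that of \<open>[X,Y]f = X(Yf) - Y(Xf)\<close>.\<close>

definition lie_bracket ::
    "'a::euclidean_space set \<Rightarrow> ('a \<Rightarrow> 'a) \<Rightarrow> ('a \<Rightarrow> 'a) \<Rightarrow> 'a \<Rightarrow> 'a" where
  "lie_bracket M X Y p = deriv_along M Y p (X p) - deriv_along M X p (Y p)"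

definition is_levi_civita ::
    "'a::euclidean_space set \<Rightarrow> ('a \<Rightarrow> 'a \<Rightarrow> 'a \<Rightarrow> real) \<Rightarrow>
     (('a \<Rightarrow> 'a) \<Rightarrow> ('a \<Rightarrow> 'a) \<Rightarrow> 'a \<Rightarrow> 'a) \<Rightarrow> bool" where
  "is_levi_civita M g D \<longleftrightarrow>
     (\<forall>X Y. vector_field M X \<longrightarrow> vector_field M Y \<longrightarrow>
        vector_field M (D X Y) \<and>
        (\<forall>p\<in>M. D X Y p - D Y X p = lie_bracket M X Y p) \<and>
        (\<forall>f :: 'a \<Rightarrow> real. smooth_within M f \<longrightarrow>
           (\<forall>p\<in>M. D (\<lambda>q. f q *\<^sub>R X q) Y p = f p *\<^sub>R D X Y p \<and>
                  D X (\<lambda>q. f q *\<^sub>R Y q) p = f p *\<^sub>R D X Y p + deriv_along M f p (X p) *\<^sub>R Y p)) \<and>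
        (\<forall>Z. vector_field M Z \<longrightarrow>
           (\<forall>p\<in>M. D (\<lambda>q. X q + Y q) Z p = D X Z p + D Y Z p \<and>
                  D Z (\<lambda>q. X q + Y q) p = D Z X p + D Z Y p \<and>
                  deriv_along M (\<lambda>q. g q (X q) (Y q)) p (Z p)
                    = g p (D Z X p) (Y p) + g p (X p) (D Z Y p))))"

text \<open>By the fundamental theorem of Riemannian geometry the choice below is unique on \<open>M\<close>.\<close>

definition levi_civita ::
    "'a::euclidean_space set \<Rightarrow> ('a \<Rightarrow> 'a \<Rightarrow> 'a \<Rightarrow> real) \<Rightarrow>
     ('a \<Rightarrow> 'a) \<Rightarrow> ('a \<Rightarrow> 'a) \<Rightarrow> 'a \<Rightarrow> 'a" where
  "levi_civita M g = (SOME D. is_levi_civita M g D)"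

definition curvature_field ::
    "'a::euclidean_space set \<Rightarrow> ('a \<Rightarrow> 'a \<Rightarrow> 'a \<Rightarrow> real) \<Rightarrow>
     ('a \<Rightarrow> 'a) \<Rightarrow> ('a \<Rightarrow> 'a) \<Rightarrow> ('a \<Rightarrow> 'a) \<Rightarrow> 'a \<Rightarrow> 'a" where
  "curvature_field M g X Y Z =
     (let D = levi_civita M g in
       (\<lambda>p. D X (D Y Z) p - D Y (D X Z) p - D (lie_bracket M X Y) Z p))"

definition orthonormal_basis_at ::
    "'a::euclidean_space set \<Rightarrow> ('a \<Rightarrow> 'a \<Rightarrow> 'a \<Rightarrow> real) \<Rightarrow> 'a \<Rightarrow> 'a set \<Rightarrow> bool" where
  "orthonormal_basis_at M g p B \<longleftrightarrow>
     finite B \<and> span B = tangent_space M p \<and>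
     (\<forall>u\<in>B. \<forall>v\<in>B. g p u v = (if u = v then 1 else 0))"


section \<open>Matrix groups with a left-invariant metric\<close>

definition SL :: "(complex^'n^'n) monoid" where
  "SL = \<lparr>carrier = {M. det M = 1}, mult = (**), one = mat 1\<rparr>"

definition matrix_lie_group :: "(complex^'n^'n) set \<Rightarrow> bool" where
  "matrix_lie_group G \<longleftrightarrow> subgroup G SL \<and> closed G"

definition left_invariant_metric ::
    "(complex^'n^'n) set \<Rightarrow>
     (complex^'n^'n \<Rightarrow> complex^'n^'n \<Rightarrow> complex^'n^'n \<Rightarrow> real) \<Rightarrow> bool" where
  "left_invariant_metric G g \<longleftrightarrow>
     (\<forall>p\<in>G. \<forall>q\<in>G. \<forall>u\<in>tangent_space G p. \<forall>v\<in>tangent_space G p.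
        g (q ** p) (q ** u) (q ** v) = g p u v) \<and>
     (\<forall>u\<in>tangent_space G (mat 1). \<forall>v\<in>tangent_space G (mat 1). \<forall>w\<in>tangent_space G (mat 1).
        g (mat 1) u v = g (mat 1) v u \<and>
        g (mat 1) (u + w) v = g (mat 1) u v + g (mat 1) w v \<and>
        (\<forall>r. g (mat 1) (r *\<^sub>R u) v = r * g (mat 1) u v) \<and>
        (u \<noteq> 0 \<longrightarrow> g (mat 1) u u > 0))"

definition left_inv_ext ::
    "complex^'n^'n \<Rightarrow> complex^'n^'n \<Rightarrow> complex^'n^'n \<Rightarrow> complex^'n^'n" where
  "left_inv_ext p u = (\<lambda>q. q ** matrix_inv p ** u)"

text \<open>Since the curvature is tensorial, its value on tangent vectors at \<open>p\<close> may be computed with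
  any extensions to vector fields; on a Lie group the left-invariant ones are available globally.\<close>

definition curvature ::
    "(complex^'n^'n) set \<Rightarrow> (complex^'n^'n \<Rightarrow> complex^'n^'n \<Rightarrow> complex^'n^'n \<Rightarrow> real) \<Rightarrow>
     complex^'n^'n \<Rightarrow> complex^'n^'n \<Rightarrow> complex^'n^'n \<Rightarrow> complex^'n^'n \<Rightarrow> complex^'n^'n" where
  "curvature G g p u v w =
     curvature_field G g (left_inv_ext p u) (left_inv_ext p v) (left_inv_ext p w) p"

definition ricci ::
    "(complex^'n^'n) set \<Rightarrow> (complex^'n^'n \<Rightarrow> complex^'n^'n \<Rightarrow> complex^'n^'n \<Rightarrow> real) \<Rightarrow>
     complex^'n^'n \<Rightarrow> complex^'n^'n \<Rightarrow> real" where
  "ricci G g p X =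
     (\<Sum>e\<in>(SOME B. orthonormal_basis_at G g p B). g p (curvature G g p e X X) e)"

definition orthonormal_pair ::
    "(complex^'n^'n) set \<Rightarrow> (complex^'n^'n \<Rightarrow> complex^'n^'n \<Rightarrow> complex^'n^'n \<Rightarrow> real) \<Rightarrow>
     complex^'n^'n \<Rightarrow> complex^'n^'n \<Rightarrow> complex^'n^'n \<Rightarrow> bool" where
  "orthonormal_pair G g p X Y \<longleftrightarrow>
     X \<in> tangent_space G p \<and> Y \<in> tangent_space G p \<and>
     g p X X = 1 \<and> g p Y Y = 1 \<and> g p X Y = 0"

definition sectional ::
    "(complex^'n^'n) set \<Rightarrow> (complex^'n^'n \<Rightarrow> complex^'n^'n \<Rightarrow> complex^'n^'n \<Rightarrow> real) \<Rightarrow>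
     complex^'n^'n \<Rightarrow> complex^'n^'n \<Rightarrow> complex^'n^'n \<Rightarrow> real" where
  "sectional G g p X Y = g p (curvature G g p X Y Y) X"

definition strictly_negative_ricci ::
    "(complex^'n^'n) set \<Rightarrow>
     (complex^'n^'n \<Rightarrow> complex^'n^'n \<Rightarrow> complex^'n^'n \<Rightarrow> real) \<Rightarrow> bool" where
  "strictly_negative_ricci G g \<longleftrightarrow>
     (\<forall>p\<in>G. \<forall>X\<in>tangent_space G p. X \<noteq> 0 \<longrightarrow> ricci G g p X < 0)"

definition einstein ::
    "(complex^'n^'n) set \<Rightarrow>
     (complex^'n^'n \<Rightarrow> complex^'n^'n \<Rightarrow> complex^'n^'n \<Rightarrow> real) \<Rightarrow> bool" where
  "einstein G g \<longleftrightarrow> (\<exists>c. \<forall>p\<in>G. \<forall>X\<in>tangent_space G p. ricci G g p X = c * g p X X)"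

definition nonpositively_curved ::
    "(complex^'n^'n) set \<Rightarrow>
     (complex^'n^'n \<Rightarrow> complex^'n^'n \<Rightarrow> complex^'n^'n \<Rightarrow> real) \<Rightarrow> bool" where
  "nonpositively_curved G g \<longleftrightarrow>
     (\<forall>p\<in>G. \<forall>X Y. orthonormal_pair G g p X Y \<longrightarrow> sectional G g p X Y \<le> 0)"

definition commutator :: "complex^'n^'n \<Rightarrow> complex^'n^'n \<Rightarrow> complex^'n^'n" where
  "commutator X Y = X ** Y - Y ** X"

text \<open>Damek-Ricci spaces, for groups given as closed matrix groups. The Lie algebra of \<open>G\<close> is its
  tangent space at the identity with the commutator as bracket, and \<open>J Z\<close> is the endomorphism
  of \<open>\<vv>\<close> that is dual to the bracket.\<close>

definition damek_ricci ::
    "(complex^'n^'n) set \<Rightarrow>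
     (complex^'n^'n \<Rightarrow> complex^'n^'n \<Rightarrow> complex^'n^'n \<Rightarrow> real) \<Rightarrow> bool" where
  "damek_ricci G g \<longleftrightarrow>
     matrix_lie_group G \<and> simply_connected G \<and> solvable (SL\<lparr>carrier := G\<rparr>) \<and>
     left_invariant_metric G g \<and>
     (\<exists>\<vv> \<zz> A0 J.
        subspace \<vv> \<and> subspace \<zz> \<and>
        tangent_space G (mat 1) = {U + Z + r *\<^sub>R A0 | U Z r. U \<in> \<vv> \<and> Z \<in> \<zz>} \<and>
        (\<forall>U\<in>\<vv>. \<forall>Z\<in>\<zz>. g (mat 1) U Z = 0) \<and>
        (\<forall>U\<in>\<vv>. g (mat 1) U A0 = 0) \<and> (\<forall>Z\<in>\<zz>. g (mat 1) Z A0 = 0) \<and>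
        g (mat 1) A0 A0 = 1 \<and>
        (\<forall>U\<in>\<vv>. \<forall>U'\<in>\<vv>. commutator U U' \<in> \<zz>) \<and>
        (\<forall>U\<in>\<vv>. \<forall>Z\<in>\<zz>. commutator U Z = 0) \<and>
        (\<forall>Z\<in>\<zz>. \<forall>Z'\<in>\<zz>. commutator Z Z' = 0) \<and>
        (\<forall>Z\<in>\<zz>. \<forall>U\<in>\<vv>.
           J Z U \<in> \<vv> \<and>
           (\<forall>U'\<in>\<vv>. g (mat 1) (J Z U) U' = g (mat 1) Z (commutator U U')) \<and>
           J Z (J Z U) = - g (mat 1) Z Z *\<^sub>R U) \<and>
        (\<forall>U\<in>\<vv>. commutator A0 U = (1/2) *\<^sub>R U) \<and>
        (\<forall>Z\<in>\<zz>. commutator A0 Z = Z))"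


section \<open>The group \<open>S = NA\<close> and its hypersurfaces\<close>

type_synonym cmat = "complex^3^3"

text \<open>In the index type \<open>3\<close> the literal \<open>3\<close> equals \<open>0\<close>, so its order must not be used to
  express triangularity.\<close>

definition cscale :: "complex \<Rightarrow> cmat \<Rightarrow> cmat" where
  "cscale c M = (\<chi> i j. c * M $ i $ j)"

definition ctranspose :: "cmat \<Rightarrow> cmat" where
  "ctranspose M = (\<chi> i j. cnj (M $ j $ i))"

definition E :: "3 \<Rightarrow> 3 \<Rightarrow> cmat" where
  "E k l = (\<chi> i j. if i = k \<and> j = l then 1 else 0)"

definition diag3 :: "real \<Rightarrow> real \<Rightarrow> real \<Rightarrow> cmat" where
  "diag3 x y z = x *\<^sub>R E 1 1 + y *\<^sub>R E 2 2 + z *\<^sub>R E 3 3"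

definition nil_alg :: "cmat set" where
  "nil_alg = {cscale v (E 1 2) + cscale w (E 2 3) + cscale z (E 1 3) | v w z. True}"

definition abel_alg :: "cmat set" where
  "abel_alg = {diag3 x y z | x y z. x + y + z = 0}"

primrec mpow :: "cmat \<Rightarrow> nat \<Rightarrow> cmat" where
  "mpow M 0 = mat 1"
| "mpow M (Suc k) = M ** mpow M k"

definition mexp :: "cmat \<Rightarrow> cmat" where
  "mexp M = (\<Sum>k. (1 / fact k) *\<^sub>R mpow M k)"

text \<open>The connected Lie subgroup with a given Lie algebra is generated by its exponentials.\<close>

definition N_grp :: "cmat set" where
  "N_grp = generate SL (mexp ` nil_alg)"

definition A_grp :: "cmat set" where
  "A_grp = generate SL (mexp ` abel_alg)"

definition S_grp :: "cmat set" where
  "S_grp = N_grp <#>\<^bsub>SL\<^esub> A_grp"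

definition diag_part :: "cmat \<Rightarrow> cmat" where
  "diag_part M = (\<chi> i j. if i = j then M $ i $ j else 0)"

text \<open>For \<open>X = Y + A\<close> with \<open>Y \<in> nil_alg\<close>, \<open>A \<in> abel_alg\<close>, \<open>diag_part X = A\<close> and
  \<open>X - diag_part X = Y\<close>.\<close>

definition inner_s :: "cmat \<Rightarrow> cmat \<Rightarrow> real" where
  "inner_s X1 X2 =
     Re (trace ((X1 - diag_part X1) ** ctranspose (X2 - diag_part X2)))
     + 2 * Re (trace (diag_part X1 ** diag_part X2))"

definition metric_S :: "cmat \<Rightarrow> cmat \<Rightarrow> cmat \<Rightarrow> real" where
  "metric_S p u v = inner_s (matrix_inv p ** u) (matrix_inv p ** v)"

text \<open>The differential of \<open>S \<rightarrow> SL(3,\<complex>)/SU(3)\<close> at the identity is the projection of the Lie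
  algebra of \<open>S\<close> onto the Hermitian matrices along the skew-Hermitian ones, so \<open>inner_s\<close> is
  the pull-back of the inner product \<open>2 Re Tr (X\<^sub>1 X\<^sub>2\<^sup>*)\<close> of the symmetric metric.\<close>

definition herm_part :: "cmat \<Rightarrow> cmat" where
  "herm_part X = (1/2) *\<^sub>R (X + ctranspose X)"

lemma inner_s_symmetric_metric:
  assumes "Y1 \<in> nil_alg" "A1 \<in> abel_alg" "Y2 \<in> nil_alg" "A2 \<in> abel_alg"
  shows "inner_s (Y1 + A1) (Y2 + A2)
       = 2 * Re (trace (herm_part (Y1 + A1) ** ctranspose (herm_part (Y2 + A2))))"
  using assms
  by (auto simp: nil_alg_def abel_alg_def inner_s_def diag_part_def herm_part_def ctranspose_def
      cscale_def diag3_def E_def trace_def matrix_matrix_mult_def sum_3 algebra_simps)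

definition H0 :: cmat where
  "H0 = diag3 (1/2) 0 (-1/2)"

definition H1 :: cmat where
  "H1 = diag3 (1 / (2 * sqrt 3)) (- 1 / sqrt 3) (1 / (2 * sqrt 3))"

definition H_dir :: "real \<Rightarrow> cmat" where
  "H_dir \<alpha> = cos \<alpha> *\<^sub>R H0 + sin \<alpha> *\<^sub>R H1"

definition S_H :: "real \<Rightarrow> cmat set" where
  "S_H \<alpha> = N_grp <#>\<^bsub>SL\<^esub> range (\<lambda>t. mexp (t *\<^sub>R H_dir \<alpha>))"

end

theory Submission
  imports Defs
begin

text \<open>The left-invariant fields form a global frame, so the Levi-Civita connection differentiates the
  coefficients of a field and adds a bilinear map \<open>\<Gamma>\<close> on the Lie algebra, and the Koszul formula shows that
  there is no other. All curvatures thus become polynomials in the coordinates of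
  \<open>aV + bW + cZ\<^sub>0 + tH\<close> and in the eigenvalues \<open>cos (\<alpha> - \<pi>/3)\<close>, \<open>cos (\<alpha> + \<pi>/3)\<close>, \<open>cos \<alpha>\<close> of \<open>ad H\<close>.
  The Ricci form is diagonal in these coordinates. The plane of \<open>(V + W + iZ\<^sub>0)/\<surd>3\<close> and
  \<open>(iV + iW + Z\<^sub>0)/\<surd>3\<close> is tangent to a flat of the symmetric space for every \<open>\<alpha>\<close>, so by the Gauss
  equation its curvature comes from the second fundamental form alone; it is \<open>4/9 sin\<^sup>2 \<alpha>\<close>. For \<open>\<alpha> = 0\<close>
  the curvature of a plane is minus a sum of squares and of a remainder that is nonnegative by
  Cauchy-Schwarz and the arithmetic-geometric mean inequality.\<close>

section \<open>Calculus of smooth maps\<close>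

text \<open>Three notions are given by a description or a choice: the derivative along a submanifold
  through the curves that represent a tangent vector, the Levi-Civita connection through its axioms,
  and the Ricci curvature through some orthonormal basis. None of them can be computed before its
  value is known to be independent of that choice. Local ambient extensions settle the first,
  existence together with uniqueness the second, invariance of the trace the third.

  The shifts by \<pi>/3 come from the roots of SL(3): in the plane of \<open>H0\<close> and
  \<open>H1\<close> the three positive roots are unit vectors at the angles \<pi>/3, -\<pi>/3 and 0,
  and \<open>H\<close> is the unit vector at angle \<alpha>. Hence the eigenvalues of ad H are the
  cosines of the angles between \<open>H\<close> and the roots.\<close>

lemma Ck_on_cong:
  assumes "open U" "\<And>x. x \<in> U \<Longrightarrow> f x = g x" "Ck_on k U f"
  shows "Ck_on k U g"
  using assms(2,3)
proof (induction k arbitrary: f g)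
  case 0
  then show ?case by (simp cong: continuous_on_cong)
next
  case (Suc k)
  have *: "(g has_derivative frechet_derivative f (at x)) (at x)" if "x \<in> U" for x
  proof (rule has_derivative_transform_within_open[OF _ assms(1) that])
    show "(f has_derivative frechet_derivative f (at x)) (at x)"
      using Suc.prems(2) that frechet_derivative_works by auto
  qed (use Suc.prems(1) in auto)
  have **: "frechet_derivative f (at x) v = frechet_derivative g (at x) v" if "x \<in> U" for x v
    using frechet_derivative_at[OF *[OF that]] by simp
  show ?case
    unfolding Ck_on.simps
  proof (intro conjI ballI allI)
    show "g differentiable at x" if "x \<in> U" for x
      using *[OF that] by (auto simp: differentiable_def)
    show "Ck_on k U (\<lambda>x. frechet_derivative g (at x) v)" for v
      by (rule Suc.IH[OF **]) (use Suc.prems in auto)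
  qed
qed

text \<open>\<open>Ck_on\<close> speaks of the derivative selected by
  \<open>frechet_derivative\<close>. On an open set any explicit derivative may stand in for it, so
  closure properties follow by induction on the order from the usual rules.\<close>

lemma Ck_on_SucI:
  assumes "open U" "\<And>x. x \<in> U \<Longrightarrow> (f has_derivative f' x) (at x)"
    "\<And>v. Ck_on k U (\<lambda>x. f' x v)"
  shows "Ck_on (Suc k) U f"
  unfolding Ck_on.simps
proof (intro conjI ballI allI)
  show "f differentiable at x" if "x \<in> U" for x
    using assms(2)[OF that] by (auto simp: differentiable_def)
  show "Ck_on k U (\<lambda>x. frechet_derivative f (at x) v)" for v
    by (rule Ck_on_cong[OF assms(1) _ assms(3)[of v]])
      (use frechet_derivative_at[OF assms(2)] in simp)
qed

lemma Ck_on_SucD: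
  assumes "Ck_on (Suc k) U f"
  shows "x \<in> U \<Longrightarrow> (f has_derivative frechet_derivative f (at x)) (at x)"
    and "Ck_on k U (\<lambda>x. frechet_derivative f (at x) v)"
  using assms frechet_derivative_works by auto

lemma Ck_on_Suc_imp: "Ck_on (Suc k) U f \<Longrightarrow> Ck_on k U f"
proof (induction k arbitrary: f)
  case 0
  then show ?case
    by (auto intro!: continuous_at_imp_continuous_on differentiable_imp_continuous_within)
next
  case (Suc k)
  then show ?case
    using Ck_on.simps(2) by blast
qed

lemma Ck_on_subset:
  assumes "V \<subseteq> U" "Ck_on k U f"
  shows "Ck_on k V f"
  using assms(2)
proof (induction k arbitrary: f)
  case 0
  then show ?case using assms(1) continuous_on_subset by auto
next
  case (Suc k)
  then show ?case using assms(1) by auto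
qed

lemma Ck_on_const: "open U \<Longrightarrow> Ck_on k U (\<lambda>x. c)"
proof (induction k arbitrary: c)
  case (Suc k)
  show ?case
    by (rule Ck_on_SucI[where f' = "\<lambda>x v. 0"]) (use Suc in auto)
qed simp

lemma Ck_on_linear:
  assumes "bounded_linear L" "open U"
  shows "Ck_on k U L"
proof (cases k)
  case 0
  then show ?thesis using assms(1) by (simp add: linear_continuous_on)
next
  case (Suc m)
  show ?thesis unfolding Suc
    by (rule Ck_on_SucI[where f' = "\<lambda>x. L"])
      (use assms in \<open>auto intro: bounded_linear_imp_has_derivative Ck_on_const\<close>)
qed

lemma Ck_on_compose_linear:
  assumes "bounded_linear L" "open U" "Ck_on k U f"
  shows "Ck_on k U (\<lambda>x. L (f x))"
  using assms(3)
proof (induction k arbitrary: f)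
  case 0
  then show ?case using assms(1)
    by (auto intro: bounded_linear.continuous_on)
next
  case (Suc k)
  show ?case
  proof (rule Ck_on_SucI[where f' = "\<lambda>x v. L (frechet_derivative f (at x) v)"])
    show "((\<lambda>x. L (f x)) has_derivative (\<lambda>v. L (frechet_derivative f (at x) v))) (at x)"
      if "x \<in> U" for x
      by (rule bounded_linear.has_derivative[OF assms(1) Ck_on_SucD(1)[OF Suc.prems that]])
    show "Ck_on k U (\<lambda>x. L (frechet_derivative f (at x) v))" for v
      by (rule Suc.IH[OF Ck_on_SucD(2)[OF Suc.prems]])
  qed fact
qed

lemma Ck_on_add:
  assumes "open U" "Ck_on k U f" "Ck_on k U g"
  shows "Ck_on k U (\<lambda>x. f x + g x)"
  using assms(2,3)
proof (induction k arbitrary: f g)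
  case 0
  then show ?case by (auto intro: continuous_on_add)
next
  case (Suc k)
  show ?case
  proof (rule Ck_on_SucI[OF assms(1), where
        f' = "\<lambda>x v. frechet_derivative f (at x) v + frechet_derivative g (at x) v"])
    show "((\<lambda>x. f x + g x) has_derivative
        (\<lambda>v. frechet_derivative f (at x) v + frechet_derivative g (at x) v)) (at x)" if "x \<in> U" for x
      by (intro has_derivative_add Ck_on_SucD(1)[OF Suc.prems(1) that]
          Ck_on_SucD(1)[OF Suc.prems(2) that])
    show "Ck_on k U (\<lambda>x. frechet_derivative f (at x) v + frechet_derivative g (at x) v)" for v
      by (intro Suc.IH Ck_on_SucD(2)[OF Suc.prems(1)] Ck_on_SucD(2)[OF Suc.prems(2)])
  qed
qed

text \<open>Covers matrix products, scalar multiples and inner products at once. Each term of the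
  product rule keeps one factor undifferentiated; \<open>Ck_on_Suc_imp\<close> lowers the order of
  that factor to fit the induction hypothesis.\<close>

lemma Ck_on_bilinear:
  assumes "bounded_bilinear h" "open U" "Ck_on k U f" "Ck_on k U g"
  shows "Ck_on k U (\<lambda>x. h (f x) (g x))"
  using assms(3,4)
proof (induction k arbitrary: f g)
  case 0
  then show ?case using assms(1) by (auto intro: bounded_bilinear.continuous_on)
next
  case (Suc k)
  show ?case
  proof (rule Ck_on_SucI[OF assms(2), where
        f' = "\<lambda>x v. h (f x) (frechet_derivative g (at x) v) + h (frechet_derivative f (at x) v) (g x)"])
    show "((\<lambda>x. h (f x) (g x)) has_derivative (\<lambda>v. h (f x) (frechet_derivative g (at x) v)
        + h (frechet_derivative f (at x) v) (g x))) (at x)" if "x \<in> U" for x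
      by (intro bounded_bilinear.FDERIV[OF assms(1)] Ck_on_SucD(1)[OF Suc.prems(1) that]
          Ck_on_SucD(1)[OF Suc.prems(2) that])
    show "Ck_on k U (\<lambda>x. h (f x) (frechet_derivative g (at x) v)
        + h (frechet_derivative f (at x) v) (g x))" for v
      by (intro Ck_on_add assms(2) Suc.IH Ck_on_SucD(2)[OF Suc.prems(1)]
          Ck_on_SucD(2)[OF Suc.prems(2)] Ck_on_Suc_imp[OF Suc.prems(1)]
          Ck_on_Suc_imp[OF Suc.prems(2)])
  qed
qed

section \<open>Smooth maps on open sets\<close>

lemma smooth_on_cong:
  "open U \<Longrightarrow> smooth_on U f \<Longrightarrow> (\<And>x. x \<in> U \<Longrightarrow> f x = g x) \<Longrightarrow> smooth_on U g"
  unfolding smooth_on_def using Ck_on_cong by blast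

lemma smooth_on_subset: "V \<subseteq> U \<Longrightarrow> smooth_on U f \<Longrightarrow> smooth_on V f"
  unfolding smooth_on_def using Ck_on_subset by blast

lemma smooth_on_linear: "bounded_linear L \<Longrightarrow> open U \<Longrightarrow> smooth_on U L"
  unfolding smooth_on_def using Ck_on_linear by blast

lemma smooth_on_const: "open U \<Longrightarrow> smooth_on U (\<lambda>x. c)"
  unfolding smooth_on_def using Ck_on_const by blast

lemma smooth_on_compose_linear:
  "bounded_linear L \<Longrightarrow> open U \<Longrightarrow> smooth_on U f \<Longrightarrow> smooth_on U (\<lambda>x. L (f x))"
  unfolding smooth_on_def using Ck_on_compose_linear by blast

lemma smooth_on_add:
  "open U \<Longrightarrow> smooth_on U f \<Longrightarrow> smooth_on U g \<Longrightarrow> smooth_on U (\<lambda>x. f x + g x)"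
  unfolding smooth_on_def using Ck_on_add by blast

lemma smooth_on_bilinear:
  "bounded_bilinear h \<Longrightarrow> open U \<Longrightarrow> smooth_on U f \<Longrightarrow> smooth_on U g \<Longrightarrow>
    smooth_on U (\<lambda>x. h (f x) (g x))"
  unfolding smooth_on_def using Ck_on_bilinear by blast

lemma smooth_on_sum:
  assumes "open U" "\<And>i. i \<in> I \<Longrightarrow> smooth_on U (f i)"
  shows "smooth_on U (\<lambda>x. \<Sum>i\<in>I. f i x)"
  using assms(2)
  by (induction I rule: infinite_finite_induct)
    (auto intro: smooth_on_const smooth_on_add assms(1))

text \<open>A directional derivative has the same shape with another vector, so the induction runs
  with \<open>A\<close> arbitrary. These maps build the curves in the groups.\<close>

lemma smooth_on_exp_scaleR:
  fixes A :: "'a::euclidean_space" and c :: real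
  assumes "open U"
  shows "smooth_on U (\<lambda>s. exp (c * s) *\<^sub>R A)"
proof -
  have "Ck_on k U (\<lambda>s. exp (c * s) *\<^sub>R A)" for k
  proof (induction k arbitrary: A)
    case 0
    then show ?case by (auto intro!: continuous_intros)
  next
    case (Suc k)
    show ?case
    proof (rule Ck_on_SucI[OF assms, where f' = "\<lambda>s v. exp (c * s) *\<^sub>R ((c * v) *\<^sub>R A)"])
      show "((\<lambda>s. exp (c * s) *\<^sub>R A) has_derivative (\<lambda>v. exp (c * s) *\<^sub>R (c * v) *\<^sub>R A)) (at s)"
        for s
        by (auto intro!: derivative_eq_intros simp: mult_ac)
    qed (rule Suc.IH)
  qed
  then show ?thesis by (simp add: smooth_on_def)
qed

lemma smooth_on_frechet_derivative:
  assumes "smooth_on U f"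
  shows "x \<in> U \<Longrightarrow> (f has_derivative frechet_derivative f (at x)) (at x)"
    and "smooth_on U (\<lambda>x. frechet_derivative f (at x) v)"
  using assms Ck_on_SucD unfolding smooth_on_def by blast+

text \<open>\<open>Ck_on\<close> controls derivatives in constant directions only; a varying
  direction is expanded in the standard basis with smooth coefficients.\<close>

lemma smooth_on_frechet_derivative_field:
  fixes f :: "'a::euclidean_space \<Rightarrow> 'b::euclidean_space"
  assumes "open U" "smooth_on U f" "smooth_on U X"
  shows "smooth_on U (\<lambda>x. frechet_derivative f (at x) (X x))"
proof (rule smooth_on_cong[OF assms(1)])
  show "smooth_on U (\<lambda>x. \<Sum>b\<in>Basis. (X x \<bullet> b) *\<^sub>R frechet_derivative f (at x) b)"
    by (intro smooth_on_sum smooth_on_bilinear[OF bounded_bilinear_scaleR] assms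
        smooth_on_compose_linear[OF bounded_linear_inner_left] smooth_on_frechet_derivative(2))
  show "(\<Sum>b\<in>Basis. (X x \<bullet> b) *\<^sub>R frechet_derivative f (at x) b)
      = frechet_derivative f (at x) (X x)" if "x \<in> U" for x
  proof -
    have "linear (frechet_derivative f (at x))"
      using smooth_on_frechet_derivative(1)[OF assms(2) that] by (rule has_derivative_linear)
    then have "frechet_derivative f (at x) (\<Sum>b\<in>Basis. (X x \<bullet> b) *\<^sub>R b)
        = (\<Sum>b\<in>Basis. (X x \<bullet> b) *\<^sub>R frechet_derivative f (at x) b)"
      by (simp add: linear_sum linear_scale)
    then show ?thesis by (simp add: euclidean_representation)
  qed
qed

section \<open>Smooth maps on a submanifold, through local extensions\<close>

lemma smooth_within_cong:
  "smooth_within M f \<Longrightarrow> (\<And>x. x \<in> M \<Longrightarrow> f x = g x) \<Longrightarrow> smooth_within M g"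
  unfolding smooth_within_def by (metis IntD2)

lemma smooth_on_imp_smooth_within: "smooth_on UNIV f \<Longrightarrow> smooth_within M f"
  unfolding smooth_within_def by auto

lemma smooth_within_const: "smooth_within M (\<lambda>x. c)"
  by (intro smooth_on_imp_smooth_within smooth_on_const) auto

lemma smooth_within_linear: "bounded_linear L \<Longrightarrow> smooth_within M L"
  by (intro smooth_on_imp_smooth_within smooth_on_linear) auto

lemma smooth_within_compose_linear:
  assumes "bounded_linear L" "smooth_within M f"
  shows "smooth_within M (\<lambda>x. L (f x))"
  unfolding smooth_within_def
proof
  fix p assume "p \<in> M"
  then obtain U F where U: "open U" "p \<in> U" "smooth_on U F" "\<forall>x\<in>U \<inter> M. F x = f x"
    using assms(2) unfolding smooth_within_def by blast
  have "smooth_on U (\<lambda>x. L (F x))"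
    by (rule smooth_on_compose_linear[OF assms(1) U(1,3)])
  moreover have "\<forall>x\<in>U \<inter> M. L (F x) = L (f x)"
    using U(4) by simp
  ultimately show "\<exists>U F. open U \<and> p \<in> U \<and> smooth_on U F \<and> (\<forall>x\<in>U \<inter> M. F x = L (f x))"
    using U(1,2) by blast
qed

lemma smooth_withinE:
  assumes "smooth_within M f" "p \<in> M"
  obtains U F where "open U" "p \<in> U" "smooth_on U F" "\<forall>x\<in>U \<inter> M. F x = f x"
  using assms unfolding smooth_within_def by blast

lemma smooth_within_pair:
  assumes "smooth_within M f" "smooth_within M g" "p \<in> M"
  obtains U F G where "open U" "p \<in> U" "smooth_on U F" "smooth_on U G"
    "\<forall>x\<in>U \<inter> M. F x = f x \<and> G x = g x"
proof -
  obtain U F where U: "open U" "p \<in> U" "smooth_on U F" "\<forall>x\<in>U \<inter> M. F x = f x"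
    by (rule smooth_withinE[OF assms(1,3)])
  obtain V G where V: "open V" "p \<in> V" "smooth_on V G" "\<forall>x\<in>V \<inter> M. G x = g x"
    by (rule smooth_withinE[OF assms(2,3)])
  show thesis
  proof (rule that[of "U \<inter> V" F G])
    show "open (U \<inter> V)" "p \<in> U \<inter> V"
      using U V by auto
    show "smooth_on (U \<inter> V) F" "smooth_on (U \<inter> V) G"
      by (rule smooth_on_subset[OF _ U(3)], simp, rule smooth_on_subset[OF _ V(3)], simp)
    show "\<forall>x\<in>U \<inter> V \<inter> M. F x = f x \<and> G x = g x"
      using U(4) V(4) by simp
  qed
qed

lemma smooth_within_bilinear:
  assumes "bounded_bilinear h" "smooth_within M f" "smooth_within M g"
  shows "smooth_within M (\<lambda>x. h (f x) (g x))"
  unfolding smooth_within_def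
proof
  fix p assume "p \<in> M"
  then obtain U F G where U: "open U" "p \<in> U" "smooth_on U F" "smooth_on U G"
    "\<forall>x\<in>U \<inter> M. F x = f x \<and> G x = g x"
    by (rule smooth_within_pair[OF assms(2,3)])
  have "smooth_on U (\<lambda>x. h (F x) (G x))"
    by (rule smooth_on_bilinear[OF assms(1) U(1,3,4)])
  moreover have "\<forall>x\<in>U \<inter> M. h (F x) (G x) = h (f x) (g x)"
    using U(5) by simp
  ultimately show "\<exists>U F. open U \<and> p \<in> U \<and> smooth_on U F \<and> (\<forall>x\<in>U \<inter> M. F x = h (f x) (g x))"
    using U(1,2) by blast
qed

lemma smooth_within_add:
  assumes "smooth_within M f" "smooth_within M g"
  shows "smooth_within M (\<lambda>x. f x + g x)"
  unfolding smooth_within_def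
proof
  fix p assume "p \<in> M"
  then obtain U F G where U: "open U" "p \<in> U" "smooth_on U F" "smooth_on U G"
    "\<forall>x\<in>U \<inter> M. F x = f x \<and> G x = g x"
    by (rule smooth_within_pair[OF assms])
  have "smooth_on U (\<lambda>x. F x + G x)"
    by (rule smooth_on_add[OF U(1,3,4)])
  moreover have "\<forall>x\<in>U \<inter> M. F x + G x = f x + g x"
    using U(5) by simp
  ultimately show "\<exists>U F. open U \<and> p \<in> U \<and> smooth_on U F \<and> (\<forall>x\<in>U \<inter> M. F x = f x + g x)"
    using U(1,2) by blast
qed

section \<open>Derivatives along a submanifold\<close>

text \<open>\<open>D\<close> is the derivative of some local extension. It depends on the extension
  away from the tangent space, and only its values on tangent vectors are meaningful.\<close>

definition has_deriv_along ::
    "'a::euclidean_space set \<Rightarrow> ('a \<Rightarrow> 'b::euclidean_space) \<Rightarrow> 'a \<Rightarrow> ('a \<Rightarrow> 'b) \<Rightarrow> bool" where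
  "has_deriv_along M f p D \<longleftrightarrow>
     (\<exists>U F. open U \<and> p \<in> U \<and> (F has_derivative D) (at p) \<and> (\<forall>x\<in>U \<inter> M. F x = f x))"

text \<open>Chain rule for a local extension \<open>F\<close>: for small times the curve stays in
  \<open>M\<close> and in the neighbourhood, where \<open>F\<close> and \<open>f\<close> agree, and
  the derivative at 0 sees no more.\<close>

lemma has_deriv_along_curve:
  assumes "has_deriv_along M f p D" "curve_in M p v \<gamma>"
  shows "((f \<circ> \<gamma>) has_vector_derivative D v) (at 0)"
proof -
  obtain U F where U: "open U" "p \<in> U" "(F has_derivative D) (at p)" "\<forall>x\<in>U \<inter> M. F x = f x"
    using assms(1) unfolding has_deriv_along_def by blast
  obtain \<epsilon> where e: "\<epsilon> > 0" "\<gamma> ` {-\<epsilon><..<\<epsilon>} \<subseteq> M" and g0: "\<gamma> 0 = p"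
    and g': "(\<gamma> has_vector_derivative v) (at 0)"
    using assms(2) unfolding curve_in_def by blast
  have "((F \<circ> \<gamma>) has_vector_derivative D v) (at 0)"
    by (rule vector_derivative_diff_chain_within[OF g'])
      (use U(3) g0 in \<open>auto intro: has_derivative_at_withinI\<close>)
  moreover have "\<forall>\<^sub>F s in at 0. (F \<circ> \<gamma>) s = (f \<circ> \<gamma>) s"
  proof -
    have "(\<gamma> \<longlongrightarrow> \<gamma> 0) (at 0)"
      using has_vector_derivative_continuous[OF g'] by (simp add: continuous_at)
    then have "\<forall>\<^sub>F s in at 0. \<gamma> s \<in> U"
      using U g0 by (auto intro: topological_tendstoD)
    moreover have "\<forall>\<^sub>F s in at 0. s \<in> {-\<epsilon><..<\<epsilon>}"
      using e(1) by (intro eventually_at_in_open') auto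
    ultimately show ?thesis
      by eventually_elim (use U(4) e(2) in \<open>auto simp: image_subset_iff\<close>)
  qed
  moreover have "(F \<circ> \<gamma>) 0 = (f \<circ> \<gamma>) 0"
    using U g0 e by (force simp: image_subset_iff)
  ultimately show ?thesis
    unfolding has_vector_derivative_def
    using has_derivative_transform_eventually by blast
qed

text \<open>Tangency supplies a curve, which makes the number described in
  \<open>deriv_along\<close> unique; without any curve the description would be vacuous.\<close>

lemma deriv_along_eq:
  assumes "has_deriv_along M f p D" "v \<in> tangent_space M p"
  shows "deriv_along M f p v = D v"
proof -
  obtain \<gamma> where "curve_in M p v \<gamma>"
    using assms(2) by (auto simp: tangent_space_def)
  then show ?thesis
    unfolding deriv_along_def
    using has_deriv_along_curve[OF assms(1)] vector_derivative_unique_at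
    by (intro the_equality) blast+
qed

lemma has_deriv_along_cong:
  "has_deriv_along M f p D \<Longrightarrow> (\<And>x. x \<in> M \<Longrightarrow> f x = g x) \<Longrightarrow> has_deriv_along M g p D"
  unfolding has_deriv_along_def by (metis IntD2)

lemma has_deriv_along_linear:
  "bounded_linear L \<Longrightarrow> has_deriv_along M L p L"
  unfolding has_deriv_along_def
  by (intro exI[of _ UNIV] exI[of _ L]) (auto intro: bounded_linear_imp_has_derivative)

lemma has_deriv_along_const: "has_deriv_along M (\<lambda>x. c) p (\<lambda>v. 0)"
  unfolding has_deriv_along_def
  by (intro exI[of _ UNIV] exI[of _ "\<lambda>x. c"]) auto

lemma has_deriv_along_compose_linear:
  assumes "bounded_linear L" "has_deriv_along M f p D"
  shows "has_deriv_along M (\<lambda>x. L (f x)) p (\<lambda>v. L (D v))"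
proof -
  obtain U F where "open U" "p \<in> U" "(F has_derivative D) (at p)" "\<forall>x\<in>U \<inter> M. F x = f x"
    using assms(2) unfolding has_deriv_along_def by blast
  then have "open U \<and> p \<in> U \<and> ((\<lambda>x. L (F x)) has_derivative (\<lambda>v. L (D v))) (at p) \<and>
      (\<forall>x\<in>U \<inter> M. L (F x) = L (f x))"
    by (simp add: bounded_linear.has_derivative[OF assms(1)])
  then show ?thesis
    unfolding has_deriv_along_def by blast
qed

lemma has_deriv_along_pair:
  assumes "has_deriv_along M f p D" "has_deriv_along M g p D'"
  obtains U F G where "open U" "p \<in> U" "(F has_derivative D) (at p)" "(G has_derivative D') (at p)"
    "\<forall>x\<in>U \<inter> M. F x = f x \<and> G x = g x"
proof -
  obtain U F where U: "open U" "p \<in> U" "(F has_derivative D) (at p)" "\<forall>x\<in>U \<inter> M. F x = f x"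
    using assms unfolding has_deriv_along_def by blast
  obtain V G where V: "open V" "p \<in> V" "(G has_derivative D') (at p)" "\<forall>x\<in>V \<inter> M. G x = g x"
    using assms unfolding has_deriv_along_def by blast
  show thesis
    by (rule that[of "U \<inter> V" F G]) (use U V in auto)
qed

lemma has_deriv_along_add:
  assumes "has_deriv_along M f p D" "has_deriv_along M g p D'"
  shows "has_deriv_along M (\<lambda>x. f x + g x) p (\<lambda>v. D v + D' v)"
proof -
  obtain U F G where "open U" "p \<in> U" "(F has_derivative D) (at p)" "(G has_derivative D') (at p)"
    "\<forall>x\<in>U \<inter> M. F x = f x \<and> G x = g x"
    by (rule has_deriv_along_pair[OF assms])
  then have "open U \<and> p \<in> U \<and> ((\<lambda>x. F x + G x) has_derivative (\<lambda>v. D v + D' v)) (at p) \<and>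
      (\<forall>x\<in>U \<inter> M. F x + G x = f x + g x)"
    by (simp add: has_derivative_add)
  then show ?thesis
    unfolding has_deriv_along_def by blast
qed

lemma has_deriv_along_bilinear:
  assumes "bounded_bilinear h" "has_deriv_along M f p D" "has_deriv_along M g p D'" "p \<in> M"
  shows "has_deriv_along M (\<lambda>x. h (f x) (g x)) p (\<lambda>v. h (f p) (D' v) + h (D v) (g p))"
proof -
  obtain U F G where *: "open U" "p \<in> U" "(F has_derivative D) (at p)" "(G has_derivative D') (at p)"
    "\<forall>x\<in>U \<inter> M. F x = f x \<and> G x = g x"
    by (rule has_deriv_along_pair[OF assms(2,3)])
  have "((\<lambda>x. h (F x) (G x)) has_derivative (\<lambda>v. h (F p) (D' v) + h (D v) (G p))) (at p)"
    by (rule bounded_bilinear.FDERIV[OF assms(1) *(3,4)])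
  then have "open U \<and> p \<in> U \<and>
      ((\<lambda>x. h (F x) (G x)) has_derivative (\<lambda>v. h (f p) (D' v) + h (D v) (g p))) (at p) \<and>
      (\<forall>x\<in>U \<inter> M. h (F x) (G x) = h (f x) (g x))"
    using * assms(4) by simp
  then show ?thesis
    unfolding has_deriv_along_def by blast
qed

lemma smooth_within_has_deriv_along:
  assumes "smooth_within M f" "p \<in> M"
  obtains D where "has_deriv_along M f p D" "linear D"
proof -
  obtain U F where U: "open U" "p \<in> U" "smooth_on U F" "\<forall>x\<in>U \<inter> M. F x = f x"
    using assms unfolding smooth_within_def by blast
  have "(F has_derivative frechet_derivative F (at p)) (at p)"
    using smooth_on_frechet_derivative(1) U by blast
  then show thesis
    using that[of "frechet_derivative F (at p)"] U has_derivative_linear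
    unfolding has_deriv_along_def by blast
qed

text \<open>The Frechet derivative of one local extension serves at all points of \<open>M\<close>
  in its neighbourhood, so a single smooth ambient formula represents the derivative there.\<close>

lemma smooth_within_deriv_along:
  assumes "smooth_within M f" "vector_field M X"
  shows "smooth_within M (\<lambda>p. deriv_along M f p (X p))"
  unfolding smooth_within_def
proof
  fix p assume "p \<in> M"
  moreover have "smooth_within M X"
    using assms(2) by (simp add: vector_field_def)
  ultimately obtain U F Y where U: "open U" "p \<in> U" "smooth_on U F" "smooth_on U Y"
    "\<forall>x\<in>U \<inter> M. F x = f x \<and> Y x = X x"
    using smooth_within_pair[OF assms(1)] by metis
  have "frechet_derivative F (at x) (Y x) = deriv_along M f x (X x)" if "x \<in> U \<inter> M" for x
  proof -
    have "has_deriv_along M f x (frechet_derivative F (at x))"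
      unfolding has_deriv_along_def
      using U that smooth_on_frechet_derivative(1) by (intro exI[of _ U] exI[of _ F]) auto
    then show ?thesis
      using deriv_along_eq assms(2) U(5) that by (fastforce simp: vector_field_def)
  qed
  moreover have "smooth_on U (\<lambda>x. frechet_derivative F (at x) (Y x))"
    by (rule smooth_on_frechet_derivative_field[OF U(1,3,4)])
  ultimately show "\<exists>U G. open U \<and> p \<in> U \<and> smooth_on U G \<and>
      (\<forall>x\<in>U \<inter> M. G x = deriv_along M f x (X x))"
    using U(1,2) by blast
qed

lemma vector_field_cong:
  "vector_field M X \<Longrightarrow> (\<And>x. x \<in> M \<Longrightarrow> X x = Y x) \<Longrightarrow> vector_field M Y"
  unfolding vector_field_def using smooth_within_cong[of M X Y] by auto

section \<open>Left-invariant metrics on matrix groups\<close>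

lemma bounded_bilinear_matrix_mult:
  "bounded_bilinear ((**) :: complex^'n^'m \<Rightarrow> complex^'k^'n \<Rightarrow> complex^'k^'m)"
  unfolding bilinear_conv_bounded_bilinear[symmetric] bilinear_def
  by (auto intro!: linearI simp: vec_eq_iff matrix_matrix_mult_def algebra_simps sum.distrib
      scaleR_sum_right)

lemmas matrix_mult_bilinear_simps =
  bounded_bilinear.add_left[OF bounded_bilinear_matrix_mult]
  bounded_bilinear.add_right[OF bounded_bilinear_matrix_mult]
  bounded_bilinear.diff_left[OF bounded_bilinear_matrix_mult]
  bounded_bilinear.diff_right[OF bounded_bilinear_matrix_mult]
  bounded_bilinear.scaleR_left[OF bounded_bilinear_matrix_mult]
  bounded_bilinear.scaleR_right[OF bounded_bilinear_matrix_mult]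
  bounded_bilinear.zero_left[OF bounded_bilinear_matrix_mult]
  bounded_bilinear.zero_right[OF bounded_bilinear_matrix_mult]

text \<open>\<open>\<Gamma>\<close> is the Levi-Civita connection on left-invariant fields: \<open>\<nabla>\<^sub>u v\<close> for \<open>u\<close>, \<open>v\<close> in the Lie algebra,
  whose inner product is the one of the Euclidean space \<open>'v\<close>.\<close>

locale metric_lie_algebra =
  fixes br \<Gamma> :: "'v::euclidean_space \<Rightarrow> 'v \<Rightarrow> 'v"
  assumes bilinear_connection: "bounded_bilinear \<Gamma>"
    and torsion_free: "\<Gamma> u v - \<Gamma> v u = br u v"
    and skew_connection: "\<Gamma> u v \<bullet> w + v \<bullet> \<Gamma> u w = 0"
begin

definition riem :: "'v \<Rightarrow> 'v \<Rightarrow> 'v \<Rightarrow> 'v" where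
  "riem u v w = \<Gamma> u (\<Gamma> v w) - \<Gamma> v (\<Gamma> u w) - \<Gamma> (br u v) w"

lemma linear_riem: "linear (\<lambda>u. riem u v w)"
proof -
  interpret bounded_bilinear \<Gamma> by (rule bilinear_connection)
  show ?thesis
    unfolding riem_def torsion_free[symmetric]
    by (rule linearI) (simp_all add: add_left add_right diff_left scaleR_left scaleR_right
        scaleR_diff_right)
qed

lemma riem_skew: "riem v u w = - riem u v w"
proof -
  have "br v u = - br u v"
    by (simp add: torsion_free[symmetric])
  then show ?thesis
    by (simp add: riem_def bounded_bilinear.minus_left[OF bilinear_connection])
qed

text \<open>Every \<open>\<Gamma> u\<close> is a skew endomorphism, and so are commutators and
  differences of such endomorphisms.\<close>

lemma riem_inner_skew: "riem u v w \<bullet> z = - (riem u v z \<bullet> w)"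
proof -
  have *: "\<Gamma> u v \<bullet> w = - (\<Gamma> u w \<bullet> v)" for u v w
    using skew_connection[of u v w] by (simp add: inner_commute)
  have "\<Gamma> u (\<Gamma> v w) \<bullet> z = \<Gamma> v (\<Gamma> u z) \<bullet> w" for u v
    using *[of u "\<Gamma> v w" z] *[of v w "\<Gamma> u z"] by (simp add: inner_commute)
  then show ?thesis
    using *[of "br u v" w z] by (simp add: riem_def inner_diff_left)
qed

text \<open>The curvature is alternating in its first two arguments, so a change of basis in their
  plane multiplies it by the determinant.\<close>

lemma riem_rotate:
  "riem (r *\<^sub>R u + s *\<^sub>R v) (r *\<^sub>R v - s *\<^sub>R u) w = (r\<^sup>2 + s\<^sup>2) *\<^sub>R riem u v w"
proof -
  have self: "riem x x w = 0" for x
    by (simp add: riem_def torsion_free[symmetric] bounded_bilinear.zero_left[OF bilinear_connection])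
  have right: "riem x (r *\<^sub>R v - s *\<^sub>R u) w = r *\<^sub>R riem x v w - s *\<^sub>R riem x u w" for x
    using riem_skew[of x _ w]
    by (simp add: linear_diff[OF linear_riem] linear_scale[OF linear_riem])
  show ?thesis
    by (simp add: linear_add[OF linear_riem] linear_scale[OF linear_riem] right self
        riem_skew[of v u] power2_eq_square scaleR_add_left)
qed

text \<open>Rotating the first pair changes nothing by \<open>riem_rotate\<close>; in the second
  pair skewness of the curvature endomorphism yields the same determinant 1. This permits the choice
  of a convenient basis of a plane.\<close>

lemma sectional_rotate:
  fixes u v :: 'v
  assumes "r\<^sup>2 + s\<^sup>2 = 1"
  defines "x \<equiv> r *\<^sub>R u + s *\<^sub>R v" and "y \<equiv> r *\<^sub>R v - s *\<^sub>R u"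
  shows "riem x y y \<bullet> x = riem u v v \<bullet> u"
proof -
  have eq: "riem x y w = riem u v w" for w
    unfolding x_def y_def riem_rotate assms(1) by simp
  have lin: "linear (riem u v)"
  proof -
    interpret bounded_bilinear \<Gamma> by (rule bilinear_connection)
    show ?thesis
      by (rule linearI) (simp_all add: riem_def add_right scaleR_right scaleR_diff_right)
  qed
  have self: "riem u v w \<bullet> w = 0" for w
    using riem_inner_skew[of u v w w] by simp
  have "riem x y y \<bullet> x = r\<^sup>2 * (riem u v v \<bullet> u) - s\<^sup>2 * (riem u v u \<bullet> v)"
    unfolding eq by (simp add: x_def y_def linear_diff[OF lin] linear_scale[OF lin]
        inner_add_right inner_diff_left self power2_eq_square)
  also have "\<dots> = (r\<^sup>2 + s\<^sup>2) * (riem u v v \<bullet> u)"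
    using riem_inner_skew[of u v u v] by (simp add: algebra_simps)
  finally show ?thesis
    by (simp add: assms(1))
qed

end

text \<open>\<open>\<phi>\<close> models the Lie algebra on a Euclidean space so that left
  translation turns the standard basis into a global orthonormal frame.\<close>

locale left_invariant_geometry = metric_lie_algebra br \<Gamma>
  for br \<Gamma> :: "'v::euclidean_space \<Rightarrow> 'v \<Rightarrow> 'v" +
  fixes G :: "(complex^'n^'n) set"
    and g :: "complex^'n^'n \<Rightarrow> complex^'n^'n \<Rightarrow> complex^'n^'n \<Rightarrow> real"
    and \<phi> :: "'v \<Rightarrow> complex^'n^'n"
  assumes inverse_left: "p \<in> G \<Longrightarrow> matrix_inv p ** p = mat 1"
    and smooth_inverse: "smooth_within G matrix_inv"
    and linear_frame: "linear \<phi>"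
    and inj_frame: "inj \<phi>"
    and tangent_space_eq: "p \<in> G \<Longrightarrow> tangent_space G p = range (\<lambda>v. p ** \<phi> v)"
    and metric_eq: "p \<in> G \<Longrightarrow> g p (p ** \<phi> u) (p ** \<phi> v) = u \<bullet> v"
    and frame_bracket: "\<phi> (br u v) = commutator (\<phi> u) (\<phi> v)"
begin

text \<open>A linear left inverse of \<open>\<phi>\<close> on the whole matrix space, so that frame
  coordinates are smooth ambient expressions.\<close>

definition \<psi> :: "complex^'n^'n \<Rightarrow> 'v" where
  "\<psi> = (SOME h. linear h \<and> h \<circ> \<phi> = id)"

definition coord :: "(complex^'n^'n \<Rightarrow> complex^'n^'n) \<Rightarrow> complex^'n^'n \<Rightarrow> 'v" where
  "coord X q = \<psi> (matrix_inv q ** X q)"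

definition conn ::
    "(complex^'n^'n \<Rightarrow> complex^'n^'n) \<Rightarrow> (complex^'n^'n \<Rightarrow> complex^'n^'n) \<Rightarrow>
      complex^'n^'n \<Rightarrow> complex^'n^'n" where
  "conn X Y p = p ** \<phi> (deriv_along G (coord Y) p (X p) + \<Gamma> (coord X p) (coord Y p))"

section \<open>Coordinates of vector fields in the invariant frame\<close>

lemma bounded_linear_frame: "bounded_linear \<phi>"
  using linear_frame by (simp add: linear_conv_bounded_linear)

lemma \<psi>: "linear \<psi>" "\<psi> (\<phi> v) = v"
proof -
  have "\<exists>h. linear h \<and> h \<circ> \<phi> = id"
    using linear_injective_left_inverse[OF linear_frame inj_frame] by blast
  then have "linear \<psi> \<and> \<psi> \<circ> \<phi> = id"
    unfolding \<psi>_def by (rule someI_ex)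
  then show "linear \<psi>" "\<psi> (\<phi> v) = v"
    by (auto simp: fun_eq_iff)
qed

lemma bounded_linear_\<psi>: "bounded_linear \<psi>"
  using \<psi>(1) by (simp add: linear_conv_bounded_linear)

lemma left_inverse_frame: "p \<in> G \<Longrightarrow> matrix_inv p ** (p ** A) = A"
  by (simp add: matrix_mul_assoc inverse_left)

lemma coord_eqI: "p \<in> G \<Longrightarrow> X p = p ** \<phi> v \<Longrightarrow> coord X p = v"
  by (simp add: coord_def left_inverse_frame \<psi>(2))

lemma coord_frame: "p \<in> G \<Longrightarrow> coord (\<lambda>q. q ** \<phi> v) p = v"
  by (rule coord_eqI) simp_all

lemma tangentE:
  assumes "p \<in> G" "v \<in> tangent_space G p"
  obtains u where "v = p ** \<phi> u"
  using assms tangent_space_eq by blast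

lemma tangentI: "p \<in> G \<Longrightarrow> p ** \<phi> u \<in> tangent_space G p"
  using tangent_space_eq by blast

lemma vector_field_tangent: "vector_field G X \<Longrightarrow> p \<in> G \<Longrightarrow> X p \<in> tangent_space G p"
  by (simp add: vector_field_def)

lemma vector_field_coord:
  assumes "vector_field G X" "p \<in> G"
  shows "X p = p ** \<phi> (coord X p)"
  using assms by (metis coord_eqI tangentE vector_field_tangent)

lemma smooth_coord:
  assumes "vector_field G X"
  shows "smooth_within G (coord X)"
  unfolding coord_def
  by (intro smooth_within_compose_linear[OF bounded_linear_\<psi>]
      smooth_within_bilinear[OF bounded_bilinear_matrix_mult] smooth_inverse)
    (use assms in \<open>simp add: vector_field_def\<close>)

lemma vector_fieldI:
  assumes "smooth_within G c"
  shows "vector_field G (\<lambda>q. q ** \<phi> (c q))"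
  unfolding vector_field_def
  by (intro conjI ballI tangentI smooth_within_bilinear[OF bounded_bilinear_matrix_mult]
      smooth_within_compose_linear[OF bounded_linear_frame] assms
      smooth_within_linear[OF bounded_linear_ident])

text \<open>Product rule for a field written in the frame. The second term is what becomes the
  matrix commutator in the Lie bracket of two fields.\<close>

lemma deriv_along_field:
  assumes X: "vector_field G X" and p: "p \<in> G" and v: "v \<in> tangent_space G p"
  shows "deriv_along G X p v = p ** \<phi> (deriv_along G (coord X) p v) + v ** \<phi> (coord X p)"
proof -
  obtain D where D: "has_deriv_along G (coord X) p D"
    by (rule smooth_within_has_deriv_along[OF smooth_coord[OF X] p])
  have "has_deriv_along G (\<lambda>q. q ** \<phi> (coord X q)) p (\<lambda>v. p ** \<phi> (D v) + v ** \<phi> (coord X p))"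
    by (intro has_deriv_along_bilinear[OF bounded_bilinear_matrix_mult _ _ p]
        has_deriv_along_linear[OF bounded_linear_ident]
        has_deriv_along_compose_linear[OF bounded_linear_frame D])
  then have "has_deriv_along G X p (\<lambda>v. p ** \<phi> (D v) + v ** \<phi> (coord X p))"
    by (rule has_deriv_along_cong) (simp add: vector_field_coord[OF X, symmetric])
  from deriv_along_eq[OF this v] show ?thesis
    by (simp add: deriv_along_eq[OF D v])
qed

section \<open>The axioms of the Levi-Civita connection for \<open>conn\<close>\<close>

lemma vector_field_conn:
  assumes "vector_field G X" "vector_field G Y"
  shows "vector_field G (conn X Y)"
proof -
  have "smooth_within G
      (\<lambda>p. deriv_along G (coord Y) p (X p) + \<Gamma> (coord X p) (coord Y p))"
    by (intro smooth_within_add smooth_within_deriv_along smooth_coord assms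
        smooth_within_bilinear[OF bilinear_connection])
  then show ?thesis
    unfolding conn_def[abs_def] by (rule vector_fieldI)
qed

lemma conn_torsion_free:
  assumes X: "vector_field G X" and Y: "vector_field G Y" and p: "p \<in> G"
  shows "conn X Y p - conn Y X p = lie_bracket G X Y p"
proof -
  let ?x = "coord X p" and ?y = "coord Y p"
  let ?d = "\<lambda>Z v. deriv_along G (coord Z) p v"
  have "conn X Y p - conn Y X p = p ** \<phi> (?d Y (X p) - ?d X (Y p) + (\<Gamma> ?x ?y - \<Gamma> ?y ?x))"
    by (simp add: conn_def matrix_mult_bilinear_simps(1-4) linear_add[OF linear_frame]
        linear_diff[OF linear_frame] algebra_simps)
  also have "\<dots> = p ** \<phi> (?d Y (X p)) - p ** \<phi> (?d X (Y p)) + (p ** \<phi> ?x ** \<phi> ?y - p ** \<phi> ?y ** \<phi> ?x)"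
    by (simp add: torsion_free linear_add[OF linear_frame] linear_diff[OF linear_frame]
        frame_bracket commutator_def matrix_mult_bilinear_simps(1-4) matrix_mul_assoc)
  also have "\<dots> = lie_bracket G X Y p"
    using deriv_along_field[OF X p vector_field_tangent[OF Y p]]
      deriv_along_field[OF Y p vector_field_tangent[OF X p]]
      vector_field_coord[OF X p] vector_field_coord[OF Y p]
    by (simp add: lie_bracket_def)
  finally show ?thesis .
qed

lemma coord_add: "coord (\<lambda>q. X q + Y q) = (\<lambda>q. coord X q + coord Y q)"
  by (simp add: coord_def fun_eq_iff matrix_mult_bilinear_simps linear_add[OF \<psi>(1)])

lemma coord_scale: "coord (\<lambda>q. f q *\<^sub>R X q) = (\<lambda>q. f q *\<^sub>R coord X q)"
  by (simp add: coord_def fun_eq_iff matrix_mult_bilinear_simps linear_scale[OF \<psi>(1)])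

lemma conn_scale_left:
  assumes X: "vector_field G X" and Y: "vector_field G Y" and p: "p \<in> G"
  shows "conn (\<lambda>q. f q *\<^sub>R X q) Y p = f p *\<^sub>R conn X Y p"
proof -
  have *: "deriv_along G (coord Y) p (f p *\<^sub>R X p) = f p *\<^sub>R deriv_along G (coord Y) p (X p)"
  proof -
    obtain D where D: "has_deriv_along G (coord Y) p D" "linear D"
      by (rule smooth_within_has_deriv_along[OF smooth_coord[OF Y] p])
    \<comment> \<open>Tangent spaces are defined by curves; that they are closed under linear
      operations is read off from the frame.\<close>
    have "f p *\<^sub>R X p = p ** \<phi> (f p *\<^sub>R coord X p)"
      by (subst vector_field_coord[OF X p])
        (simp add: linear_scale[OF linear_frame] matrix_mult_bilinear_simps)
    then have "f p *\<^sub>R X p \<in> tangent_space G p"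
      using tangentI[OF p] by simp
    then show ?thesis
      using vector_field_tangent[OF X p]
      by (simp add: deriv_along_eq[OF D(1)] linear_scale[OF D(2)])
  qed
  show ?thesis
    by (simp add: conn_def coord_scale * bounded_bilinear.scaleR_left[OF bilinear_connection]
        linear_scale[OF linear_frame] matrix_mult_bilinear_simps linear_add[OF linear_frame]
        scaleR_add_right)
qed

lemma conn_add_left:
  assumes X: "vector_field G X" and Y: "vector_field G Y" and Z: "vector_field G Z" and p: "p \<in> G"
  shows "conn (\<lambda>q. X q + Y q) Z p = conn X Z p + conn Y Z p"
proof -
  have *: "deriv_along G (coord Z) p (X p + Y p)
      = deriv_along G (coord Z) p (X p) + deriv_along G (coord Z) p (Y p)"
  proof -
    obtain D where D: "has_deriv_along G (coord Z) p D" "linear D"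
      by (rule smooth_within_has_deriv_along[OF smooth_coord[OF Z] p])
    have "X p + Y p = p ** \<phi> (coord X p + coord Y p)"
      by (subst vector_field_coord[OF X p], subst vector_field_coord[OF Y p])
        (simp add: linear_add[OF linear_frame] matrix_mult_bilinear_simps)
    then have "X p + Y p \<in> tangent_space G p"
      using tangentI[OF p] by simp
    then show ?thesis
      using vector_field_tangent[OF X p] vector_field_tangent[OF Y p]
      by (simp add: deriv_along_eq[OF D(1)] linear_add[OF D(2)])
  qed
  show ?thesis
    by (simp add: conn_def coord_add * bounded_bilinear.add_left[OF bilinear_connection]
        linear_add[OF linear_frame] matrix_mult_bilinear_simps)
qed

lemma conn_add_right:
  assumes X: "vector_field G X" and Y: "vector_field G Y" and Z: "vector_field G Z" and p: "p \<in> G"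
  shows "conn Z (\<lambda>q. X q + Y q) p = conn Z X p + conn Z Y p"
proof -
  obtain D D' where D: "has_deriv_along G (coord X) p D" "has_deriv_along G (coord Y) p D'"
    using smooth_within_has_deriv_along[OF smooth_coord p] X Y by metis
  have "deriv_along G (\<lambda>q. coord X q + coord Y q) p (Z p)
      = deriv_along G (coord X) p (Z p) + deriv_along G (coord Y) p (Z p)"
    using vector_field_tangent[OF Z p] D has_deriv_along_add[OF D] by (simp add: deriv_along_eq)
  then show ?thesis
    by (simp add: conn_def coord_add bounded_bilinear.add_right[OF bilinear_connection]
        linear_add[OF linear_frame] matrix_mult_bilinear_simps)
qed

lemma conn_leibniz:
  fixes f :: "complex^'n^'n \<Rightarrow> real"
  assumes X: "vector_field G X" and Y: "vector_field G Y" and f: "smooth_within G f" and p: "p \<in> G"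
  shows "conn X (\<lambda>q. f q *\<^sub>R Y q) p = f p *\<^sub>R conn X Y p + deriv_along G f p (X p) *\<^sub>R Y p"
proof -
  obtain D where D: "has_deriv_along G (coord Y) p D"
    by (rule smooth_within_has_deriv_along[OF smooth_coord[OF Y] p])
  obtain D' where D': "has_deriv_along G f p D'"
    by (rule smooth_within_has_deriv_along[OF f p])
  have "deriv_along G (\<lambda>q. f q *\<^sub>R coord Y q) p (X p)
      = f p *\<^sub>R deriv_along G (coord Y) p (X p) + deriv_along G f p (X p) *\<^sub>R coord Y p"
    using vector_field_tangent[OF X p] D D'
      has_deriv_along_bilinear[OF bounded_bilinear_scaleR D' D p] by (simp add: deriv_along_eq)
  moreover have "p ** \<phi> (deriv_along G f p (X p) *\<^sub>R coord Y p) = deriv_along G f p (X p) *\<^sub>R Y p"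
    using vector_field_coord[OF Y p]
    by (simp add: linear_scale[OF linear_frame] matrix_mult_bilinear_simps)
  ultimately show ?thesis
    by (simp add: conn_def coord_scale bounded_bilinear.scaleR_right[OF bilinear_connection]
        linear_scale[OF linear_frame] linear_add[OF linear_frame] matrix_mult_bilinear_simps
        scaleR_add_right)
qed

lemma metric_coord:
  assumes "vector_field G X" "vector_field G Y" "p \<in> G"
  shows "g p (X p) (Y p) = coord X p \<bullet> coord Y p"
  using metric_eq[OF assms(3)] vector_field_coord assms by metis

text \<open>In the frame the metric is a constant inner product: differentiating the coefficients
  gives the Leibniz rule, and skewness of \<open>\<Gamma>\<close> cancels the remaining
  terms.\<close>

lemma conn_metric:
  assumes X: "vector_field G X" and Y: "vector_field G Y" and Z: "vector_field G Z" and p: "p \<in> G"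
  shows "deriv_along G (\<lambda>q. g q (X q) (Y q)) p (Z p)
      = g p (conn Z X p) (Y p) + g p (X p) (conn Z Y p)"
proof -
  let ?x = "coord X p" and ?y = "coord Y p" and ?z = "coord Z p"
  obtain D D' where D: "has_deriv_along G (coord X) p D" "has_deriv_along G (coord Y) p D'"
    using smooth_within_has_deriv_along[OF smooth_coord p] X Y by metis
  have tan: "Z p \<in> tangent_space G p"
    using vector_field_tangent[OF Z p] .
  have "has_deriv_along G (\<lambda>q. g q (X q) (Y q)) p (\<lambda>v. ?x \<bullet> D' v + D v \<bullet> ?y)"
    by (rule has_deriv_along_cong[OF has_deriv_along_bilinear[OF bounded_bilinear_inner D p]])
      (simp add: metric_coord[OF X Y])
  then have "deriv_along G (\<lambda>q. g q (X q) (Y q)) p (Z p) = ?x \<bullet> D' (Z p) + D (Z p) \<bullet> ?y"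
    using tan by (rule deriv_along_eq)
  moreover have "g p (conn Z X p) (Y p) = (D (Z p) + \<Gamma> ?z ?x) \<bullet> ?y"
    using vector_field_coord[OF Y p] metric_eq[OF p] deriv_along_eq[OF D(1) tan]
    by (metis conn_def)
  moreover have "g p (X p) (conn Z Y p) = ?x \<bullet> (D' (Z p) + \<Gamma> ?z ?y)"
    using vector_field_coord[OF X p] metric_eq[OF p] deriv_along_eq[OF D(2) tan]
    by (metis conn_def)
  ultimately show ?thesis
    using skew_connection[of ?z ?x ?y] by (simp add: inner_add_left inner_add_right)
qed

section \<open>Existence and uniqueness of the Levi-Civita connection\<close>

lemma is_levi_civita_conn: "is_levi_civita G g conn"
  unfolding is_levi_civita_def
  by (intro allI impI conjI ballI vector_field_conn conn_torsion_free conn_scale_left conn_leibniz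
      conn_add_left conn_add_right conn_metric; assumption)

text \<open>Two of the metric identities minus the third, simplified by vanishing torsion. The right
  side is free of \<open>D\<close>, so any two Levi-Civita connections share it. The brackets appear
  in frame coordinates because there the metric is the inner product.\<close>

lemma koszul:
  assumes D: "is_levi_civita G g D"
    and X: "vector_field G X" and Y: "vector_field G Y" and Z: "vector_field G Z" and p: "p \<in> G"
  shows "2 * (coord (D X Y) p \<bullet> coord Z p) =
      deriv_along G (\<lambda>q. g q (Y q) (Z q)) p (X p) + deriv_along G (\<lambda>q. g q (Z q) (X q)) p (Y p)
      - deriv_along G (\<lambda>q. g q (X q) (Y q)) p (Z p)
      + \<psi> (matrix_inv p ** lie_bracket G X Y p) \<bullet> coord Z p
      - \<psi> (matrix_inv p ** lie_bracket G X Z p) \<bullet> coord Y p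
      - \<psi> (matrix_inv p ** lie_bracket G Y Z p) \<bullet> coord X p"
proof -
  have vf: "vector_field G (D A B)" if "vector_field G A" "vector_field G B" for A B
    using D that unfolding is_levi_civita_def by blast
  have met: "deriv_along G (\<lambda>q. g q (A q) (B q)) p (C p)
      = coord (D C A) p \<bullet> coord B p + coord A p \<bullet> coord (D C B) p"
    if "vector_field G A" "vector_field G B" "vector_field G C" for A B C
  proof -
    have "deriv_along G (\<lambda>q. g q (A q) (B q)) p (C p) = g p (D C A p) (B p) + g p (A p) (D C B p)"
      using D that p unfolding is_levi_civita_def by blast
    then show ?thesis
      using metric_coord[OF _ _ p] vf that by simp
  qed
  have tor: "\<psi> (matrix_inv p ** lie_bracket G A B p) = coord (D A B) p - coord (D B A) p"
    if "vector_field G A" "vector_field G B" for A B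
  proof -
    have "D A B p - D B A p = lie_bracket G A B p"
      using D that p unfolding is_levi_civita_def by blast
    then show ?thesis
      by (metis coord_def linear_diff[OF \<psi>(1)] matrix_mult_bilinear_simps(4))
  qed
  show ?thesis
    unfolding met[OF Y Z X] met[OF Z X Y] met[OF X Y Z] tor[OF X Y] tor[OF X Z] tor[OF Y Z]
    by (simp add: inner_commute algebra_simps)
qed

lemma is_levi_civita_unique:
  assumes D: "is_levi_civita G g D"
    and X: "vector_field G X" and Y: "vector_field G Y" and p: "p \<in> G"
  shows "D X Y p = conn X Y p"
proof -
  \<comment> \<open>The test field is the invariant field through the difference of the two values
    at \<open>p\<close>; the Koszul formula then makes the squared norm of the difference
    vanish.\<close>
  let ?v = "coord (D X Y) p - coord (conn X Y) p"
  let ?Z = "\<lambda>q. q ** \<phi> ?v"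
  have Z: "vector_field G ?Z"
    by (intro vector_fieldI smooth_within_const)
  have "coord (D X Y) p \<bullet> coord ?Z p = coord (conn X Y) p \<bullet> coord ?Z p"
    using koszul[OF D X Y Z p] koszul[OF is_levi_civita_conn X Y Z p] by linarith
  moreover have "coord ?Z p = ?v"
    by (rule coord_frame[OF p])
  ultimately have "?v \<bullet> ?v = 0"
    by (simp add: inner_diff_left)
  then have "coord (D X Y) p = coord (conn X Y) p"
    by simp
  moreover have "vector_field G (D X Y)"
    using D X Y unfolding is_levi_civita_def by blast
  ultimately show ?thesis
    using vector_field_coord[OF _ p] vector_field_conn[OF X Y] by metis
qed

lemma is_levi_civita_levi_civita: "is_levi_civita G g (levi_civita G g)"
  unfolding levi_civita_def by (rule someI[of _ conn]) (rule is_levi_civita_conn)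

section \<open>Connection, bracket and curvature on invariant fields\<close>

lemma vector_field_invariant:
  assumes "\<And>q. q \<in> G \<Longrightarrow> X q = q ** \<phi> u"
  shows "vector_field G X"
  using vector_field_cong[OF vector_fieldI[OF smooth_within_const[of G u]]] assms by simp

text \<open>Coordinates of an invariant field are constant on \<open>G\<close>, so only
  \<open>\<Gamma>\<close> survives. Invariance is asked on \<open>G\<close> alone because the chosen
  connection is controlled only there; this is what lets the rule be applied to its own
  output.\<close>

lemma levi_civita_invariant:
  assumes X: "\<And>q. q \<in> G \<Longrightarrow> X q = q ** \<phi> u" and Y: "\<And>q. q \<in> G \<Longrightarrow> Y q = q ** \<phi> v"
    and p: "p \<in> G"
  shows "levi_civita G g X Y p = p ** \<phi> (\<Gamma> u v)"
proof -
  note XY = vector_field_invariant[OF X] vector_field_invariant[OF Y]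
  have "has_deriv_along G (coord Y) p (\<lambda>v. 0)"
    by (rule has_deriv_along_cong[OF has_deriv_along_const[of G v]])
      (simp add: coord_eqI Y)
  then have "deriv_along G (coord Y) p (X p) = 0"
    using deriv_along_eq vector_field_tangent[OF XY(1) p] by blast
  moreover have "coord X p = u" "coord Y p = v"
    using X Y p by (simp_all add: coord_eqI)
  ultimately show ?thesis
    using is_levi_civita_unique[OF is_levi_civita_levi_civita XY p] by (simp add: conn_def)
qed

text \<open>Read off from vanishing torsion, without differentiating the matrix fields
  again.\<close>

lemma lie_bracket_invariant:
  assumes X: "\<And>q. q \<in> G \<Longrightarrow> X q = q ** \<phi> u" and Y: "\<And>q. q \<in> G \<Longrightarrow> Y q = q ** \<phi> v"
    and p: "p \<in> G"
  shows "lie_bracket G X Y p = p ** \<phi> (br u v)"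
proof -
  have "lie_bracket G X Y p = levi_civita G g X Y p - levi_civita G g Y X p"
    using is_levi_civita_levi_civita vector_field_invariant[OF X] vector_field_invariant[OF Y] p
    unfolding is_levi_civita_def by metis
  then show ?thesis
    by (simp add: levi_civita_invariant[OF X Y p] levi_civita_invariant[OF Y X p]
        torsion_free[symmetric] linear_diff[OF linear_frame] matrix_mult_bilinear_simps)
qed

theorem curvature_eq:
  assumes p: "p \<in> G"
  shows "curvature G g p (p ** \<phi> u) (p ** \<phi> v) (p ** \<phi> w) = p ** \<phi> (riem u v w)"
proof -
  have ext: "left_inv_ext p (p ** \<phi> a) q = q ** \<phi> a" for a q
    by (simp add: left_inv_ext_def matrix_mul_assoc[symmetric] left_inverse_frame[OF p])
  let ?x = "left_inv_ext p (p ** \<phi> u)" and ?y = "left_inv_ext p (p ** \<phi> v)"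
    and ?z = "left_inv_ext p (p ** \<phi> w)" and ?D = "levi_civita G g"
  have "?D ?x (?D ?y ?z) p = p ** \<phi> (\<Gamma> u (\<Gamma> v w))" "?D ?y (?D ?x ?z) p = p ** \<phi> (\<Gamma> v (\<Gamma> u w))"
    by (intro levi_civita_invariant ext p; assumption)+
  moreover have "?D (lie_bracket G ?x ?y) ?z p = p ** \<phi> (\<Gamma> (br u v) w)"
    by (intro levi_civita_invariant lie_bracket_invariant ext p; assumption)
  ultimately show ?thesis
    unfolding curvature_def curvature_field_def Let_def riem_def
    by (simp only: linear_diff[OF linear_frame] matrix_mult_bilinear_simps)
qed

lemma frame_inj_at: "p \<in> G \<Longrightarrow> p ** \<phi> u = p ** \<phi> v \<longleftrightarrow> u = v"
  by (metis \<psi>(2) left_inverse_frame)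

lemma sectional_eq:
  assumes "p \<in> G"
  shows "sectional G g p (p ** \<phi> u) (p ** \<phi> v) = riem u v v \<bullet> u"
  unfolding sectional_def by (simp add: curvature_eq metric_eq assms)

lemma orthonormal_pair_iff:
  assumes "p \<in> G"
  shows "orthonormal_pair G g p (p ** \<phi> u) (p ** \<phi> v) \<longleftrightarrow> u \<bullet> u = 1 \<and> v \<bullet> v = 1 \<and> u \<bullet> v = 0"
  unfolding orthonormal_pair_def using assms by (simp add: metric_eq tangentI)

text \<open>The Ricci curvature is a trace, so the unknown basis chosen in its definition may be
  replaced by the standard one.\<close>

theorem ricci_eq:
  assumes p: "p \<in> G"
  shows "ricci G g p (p ** \<phi> x) = (\<Sum>e\<in>Basis. riem e x x \<bullet> e)"
proof -
  let ?L = "\<lambda>u. p ** \<phi> u"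
  have lin: "linear ?L"
    using linear_frame by (auto intro!: linearI simp: linear_add linear_scale matrix_mult_bilinear_simps)
  have inj: "inj ?L"
    using frame_inj_at[OF p] by (auto intro: injI)
  \<comment> \<open>A witness, without which the choice of a basis would say nothing.\<close>
  have "orthonormal_basis_at G g p (?L ` Basis)"
    unfolding orthonormal_basis_at_def
    using lin frame_inj_at[OF p]
    by (auto simp: linear_span_image tangent_space_eq[OF p] metric_eq[OF p] inner_Basis)
  then have "orthonormal_basis_at G g p (SOME B. orthonormal_basis_at G g p B)"
    by (rule someI)
  then obtain B where B: "orthonormal_basis_at G g p B"
    and ric: "ricci G g p (?L x) = (\<Sum>e\<in>B. g p (curvature G g p e (?L x) (?L x)) e)"
    unfolding ricci_def by blast
  have "B \<subseteq> range ?L"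
    using B span_base tangent_space_eq[OF p] unfolding orthonormal_basis_at_def by blast
  then obtain C where C: "B = ?L ` C"
    by (auto simp: subset_image_iff)
  have finC: "finite C"
    using B C inj finite_imageD[of ?L C] inj_on_subset[OF inj subset_UNIV]
    unfolding orthonormal_basis_at_def by blast
  have orth: "u \<bullet> v = (if u = v then 1 else 0)" if "u \<in> C" "v \<in> C" for u v
    using B that frame_inj_at[OF p] unfolding C orthonormal_basis_at_def by (auto simp: metric_eq[OF p])
  have spanC: "span C = UNIV"
  proof -
    have "?L ` span C = range ?L"
      using B unfolding C orthonormal_basis_at_def by (simp add: linear_span_image[OF lin] tangent_space_eq[OF p])
    then show ?thesis
      using inj by (simp add: inj_image_eq_iff)
  qed
  \<comment> \<open>An orthonormal spanning set expands each vector by its inner products.\<close>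
  have expand: "(\<Sum>c\<in>C. (v \<bullet> c) *\<^sub>R c) = v" for v
  proof -
    have "v \<in> span C"
      using spanC by simp
    then obtain r where r: "v = (\<Sum>c\<in>C. r c *\<^sub>R c)"
      unfolding span_finite[OF finC] by blast
    have "v \<bullet> c = r c" if c: "c \<in> C" for c
    proof -
      have "v \<bullet> c = (\<Sum>d\<in>C. if d = c then r d else 0)"
        unfolding r inner_sum_left by (intro sum.cong refl) (simp add: orth c)
      then show ?thesis
        using finC c by simp
    qed
    then have "(\<Sum>c\<in>C. (v \<bullet> c) *\<^sub>R c) = (\<Sum>c\<in>C. r c *\<^sub>R c)"
      by (intro sum.cong) simp_all
    then show ?thesis
      using r by simp
  qed
  have "ricci G g p (?L x) = (\<Sum>c\<in>C. riem c x x \<bullet> c)"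
    unfolding ric C
    by (subst sum.reindex[OF inj_on_subset[OF inj subset_UNIV]])
      (simp add: curvature_eq[OF p] metric_eq[OF p])
  \<comment> \<open>The double sum is expanded over the standard basis and, after the swap,
    collapsed over \<open>C\<close>.\<close>
  also have "\<dots> = (\<Sum>c\<in>C. \<Sum>e\<in>Basis. (c \<bullet> e) * (riem c x x \<bullet> e))"
    by (intro sum.cong refl) (subst euclidean_inner, simp only: mult.commute)
  also have "\<dots> = (\<Sum>e\<in>Basis. \<Sum>c\<in>C. (e \<bullet> c) * (riem c x x \<bullet> e))"
    by (subst sum.swap) (simp only: inner_commute)
  also have "\<dots> = (\<Sum>e\<in>Basis. riem (\<Sum>c\<in>C. (e \<bullet> c) *\<^sub>R c) x x \<bullet> e)"
    by (simp add: linear_sum[OF linear_riem] linear_scale[OF linear_riem] inner_sum_left)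
  finally show ?thesis
    by (simp add: expand)
qed

end

section \<open>The solvable Lie algebras\<close>

text \<open>\<open>(a, b, c, t)\<close> stands for \<open>aV + bW + cZ\<^sub>0 + tH\<close>; \<open>p\<close>, \<open>q\<close>, \<open>p + q\<close> are the eigenvalues of \<open>ad H\<close> on
  the complex lines of \<open>V\<close>, \<open>W\<close>, \<open>Z\<^sub>0\<close>. The connection is obtained by solving the Koszul formula.\<close>

type_synonym lie7 = "complex \<times> complex \<times> complex \<times> real"

definition bracket7 :: "real \<Rightarrow> real \<Rightarrow> lie7 \<Rightarrow> lie7 \<Rightarrow> lie7" where
  "bracket7 p q = (\<lambda>(a, b, c, t) (a', b', c', t').
     (p *\<^sub>R (t *\<^sub>R a' - t' *\<^sub>R a), q *\<^sub>R (t *\<^sub>R b' - t' *\<^sub>R b),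
      (p + q) *\<^sub>R (t *\<^sub>R c' - t' *\<^sub>R c) + (a * b' - a' * b), 0))"

definition connection7 :: "real \<Rightarrow> real \<Rightarrow> lie7 \<Rightarrow> lie7 \<Rightarrow> lie7" where
  "connection7 p q = (\<lambda>(a, b, c, t) (a', b', c', t').
     ((1/2) *\<^sub>R (cnj b * c' + cnj b' * c) - (p * t') *\<^sub>R a,
      - (1/2) *\<^sub>R (cnj a * c' + cnj a' * c) - (q * t') *\<^sub>R b,
      (1/2) *\<^sub>R (a * b' - a' * b) - ((p + q) * t') *\<^sub>R c,
      p * (a \<bullet> a') + q * (b \<bullet> b') + (p + q) * (c \<bullet> c')))"

lemma bilinear_connection7: "bounded_bilinear (connection7 p q)"
  unfolding bilinear_conv_bounded_bilinear[symmetric] bilinear_def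
  by (auto intro!: linearI simp: connection7_def complex_eq_iff inner_complex_def algebra_simps)

lemma torsion_free_connection7: "connection7 p q u v - connection7 p q v u = bracket7 p q u v"
  by (cases u, cases v) (simp add: connection7_def bracket7_def complex_eq_iff inner_commute algebra_simps)

lemma skew_connection7: "connection7 p q u v \<bullet> w + v \<bullet> connection7 p q u w = 0"
  by (cases u, cases v, cases w) (simp add: connection7_def inner_complex_def algebra_simps)

interpretation lie7: metric_lie_algebra "bracket7 p q" "connection7 p q" for p q
  by (intro metric_lie_algebra.intro bilinear_connection7 torsion_free_connection7 skew_connection7)

section \<open>Curvature polynomials\<close>

lemma sum_Basis_lie7:
  fixes f :: "lie7 \<Rightarrow> real"
  shows "(\<Sum>e\<in>Basis. f e) = f (1, 0, 0, 0) + f (\<i>, 0, 0, 0) + f (0, 1, 0, 0) + f (0, \<i>, 0, 0)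
    + f (0, 0, 1, 0) + f (0, 0, \<i>, 0) + f (0, 0, 0, 1)"
  by (simp add: Basis_prod_def Basis_complex_def zero_prod_def image_Un add.assoc)

text \<open>The constants -1, -1, 1 are the Ricci curvatures of the complex Heisenberg algebra. The
  other terms in \<open>a\<close>, \<open>b\<close>, \<open>c\<close> are minus the trace
  \<open>4 * (p + q)\<close> of ad H times its eigenvalues, and the coefficient of \<open>t\<close>
  is minus the trace of its square.\<close>

lemma ricci7:
  "(\<Sum>e\<in>Basis. lie7.riem p q e (a, b, c, t) (a, b, c, t) \<bullet> e) =
     - (1 + 4 * (p + q) * p) * (cmod a)\<^sup>2 - (1 + 4 * (p + q) * q) * (cmod b)\<^sup>2
     + (1 - 4 * (p + q)\<^sup>2) * (cmod c)\<^sup>2 - 2 * (p\<^sup>2 + q\<^sup>2 + (p + q)\<^sup>2) * t\<^sup>2"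
  unfolding sum_Basis_lie7 lie7.riem_def cmod_power2
  by (simp add: connection7_def bracket7_def
      inner_complex_def power2_eq_square algebra_simps)

text \<open>The eigenvalues 1/2, 1/2, 1 belong to \<alpha> = 0. The expression is grouped for an
  estimate: the first two summands are visibly nonpositive, and the last bracket collects the
  Cauchy-Schwarz defects and the mixed terms.\<close>

lemma sectional7_flat_horizontal:
  fixes a b c a' b' c' :: complex and t :: real
  defines "P \<equiv> a * b' - a' * b"
  shows "lie7.riem (1/2) (1/2) (a, b, c, t) (a', b', c', 0) (a', b', c', 0) \<bullet> (a, b, c, t) =
    - (3/4) * (cmod (P + t *\<^sub>R c'))\<^sup>2 - (t\<^sup>2 / 4) * ((cmod a')\<^sup>2 + (cmod b')\<^sup>2 + (cmod c')\<^sup>2)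
    - ((((cmod a)\<^sup>2 + (cmod b)\<^sup>2) * ((cmod a')\<^sup>2 + (cmod b')\<^sup>2) - (a \<bullet> a' + b \<bullet> b')\<^sup>2) / 4
      + ((cmod c)\<^sup>2 * (cmod c')\<^sup>2 - (c \<bullet> c')\<^sup>2)
      + ((cmod a')\<^sup>2 + (cmod b')\<^sup>2) * (cmod c)\<^sup>2 / 4 + ((cmod a)\<^sup>2 + (cmod b)\<^sup>2) * (cmod c')\<^sup>2 / 4
      - 2 * (a \<bullet> a' + b \<bullet> b') * (c \<bullet> c')
      + 3/2 * Re (c' * cnj c * (a * cnj a' + b * cnj b')))"
  unfolding lie7.riem_def P_def cmod_power2
  by (simp add: connection7_def bracket7_def inner_complex_def power2_eq_square)
    (simp add: field_simps)

text \<open>The product of the Hermitian parts of the two vectors is a real multiple of the first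
  part, hence Hermitian, so the parts commute; this is why the plane is tangent to a flat. The
  factor \<open>1 - (p + q)\<^sup>2\<close> becomes \<open>(sin \<alpha>)\<^sup>2\<close>.\<close>

lemma sectional7_positive:
  fixes p q r :: real
  defines "x \<equiv> (of_real r, of_real r, of_real r * \<i>, 0)" and "y \<equiv> (of_real r * \<i>, of_real r * \<i>, of_real r, 0)"
  shows "lie7.riem p q x y y \<bullet> x = 4 * r ^ 4 * (1 - (p + q)\<^sup>2)"
  unfolding lie7.riem_def x_def y_def
  by (simp add: connection7_def bracket7_def inner_complex_def power2_eq_square power4_eq_xxxx
      algebra_simps)

lemma sectional7_negative:
  "lie7.riem p q (1, 0, 0, 0) (0, 0, 0, 1) (0, 0, 0, 1) \<bullet> (1, 0, 0, 0) = - p\<^sup>2"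
  unfolding lie7.riem_def
  by (simp add: connection7_def bracket7_def inner_complex_def power2_eq_square algebra_simps)

text \<open>After Cauchy-Schwarz the mixed term is at worst -3/2 UVZW. Of this, -UVZW completes the
  square of UV/2 - ZW and the remaining half completes a quarter of the square of VZ - UW. The terms
  in \<open>h\<close> leave 2 - 1 - 1/4 = 3/4.\<close>

lemma sectional7_nonpos_horizontal:
  assumes "(a \<bullet> a' + b \<bullet> b') + c \<bullet> c' = 0"
  shows "lie7.riem (1/2) (1/2) (a, b, c, t) (a', b', c', 0) (a', b', c', 0) \<bullet> (a, b, c, t) \<le> 0"
proof -
  define U V Z W where "U = sqrt ((cmod a)\<^sup>2 + (cmod b)\<^sup>2)" and "V = sqrt ((cmod a')\<^sup>2 + (cmod b')\<^sup>2)"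
    and "Z = cmod c" and "W = cmod c'"
  have nonneg: "U \<ge> 0" "V \<ge> 0" "Z \<ge> 0" "W \<ge> 0"
    by (simp_all add: U_def V_def Z_def W_def)
  have sq: "(cmod a)\<^sup>2 + (cmod b)\<^sup>2 = U\<^sup>2" "(cmod a')\<^sup>2 + (cmod b')\<^sup>2 = V\<^sup>2"
    by (simp_all add: U_def V_def)
  define h where "h = c \<bullet> c'"
  have h: "a \<bullet> a' + b \<bullet> b' = - h"
    using assms by (simp add: h_def)
  have "cmod (a * cnj a' + b * cnj b') \<le> cmod a * cmod a' + cmod b * cmod b'"
    by (rule order_trans[OF norm_triangle_ineq]) (simp add: norm_mult)
  also have "\<dots> \<le> U * V"
  proof (rule power2_le_imp_le)
    \<comment> \<open>Lagrange's identity, for the pairs of absolute values.\<close>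
    have "(U * V)\<^sup>2 - (cmod a * cmod a' + cmod b * cmod b')\<^sup>2 = (cmod a * cmod b' - cmod b * cmod a')\<^sup>2"
      unfolding power_mult_distrib sq[symmetric] by (simp add: power2_eq_square algebra_simps)
    then show "(cmod a * cmod a' + cmod b * cmod b')\<^sup>2 \<le> (U * V)\<^sup>2"
      by (smt (verit) zero_le_power2)
  qed (simp add: nonneg)
  finally have "cmod (c' * cnj c * (a * cnj a' + b * cnj b')) \<le> W * Z * (U * V)"
    using nonneg by (simp add: norm_mult W_def Z_def mult_left_mono)
  then have X: "Re (c' * cnj c * (a * cnj a' + b * cnj b')) \<ge> - (W * Z * (U * V))"
    using abs_Re_le_cmod[of "c' * cnj c * (a * cnj a' + b * cnj b')"] by linarith
  txt \<open>The hypothesis enters through \<open>h\<close>: it makes the mixed term \<open>2 h\<^sup>2\<close> nonnegative, enough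
    to absorb both Cauchy-Schwarz defects.\<close>
  have "0 \<le> (U * V / 2 - Z * W)\<^sup>2 + (V * Z - U * W)\<^sup>2 / 4 + 3/4 * h\<^sup>2"
    by simp
  also have "\<dots> = (U\<^sup>2 * V\<^sup>2 - (- h)\<^sup>2) / 4 + (Z\<^sup>2 * W\<^sup>2 - h\<^sup>2) + V\<^sup>2 * Z\<^sup>2 / 4 + U\<^sup>2 * W\<^sup>2 / 4
      - 2 * (- h) * h + 3/2 * - (W * Z * (U * V))"
    by (simp add: power2_eq_square field_simps)
  also have "\<dots> \<le> (U\<^sup>2 * V\<^sup>2 - (- h)\<^sup>2) / 4 + (Z\<^sup>2 * W\<^sup>2 - h\<^sup>2) + V\<^sup>2 * Z\<^sup>2 / 4 + U\<^sup>2 * W\<^sup>2 / 4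
      - 2 * (- h) * h + 3/2 * Re (c' * cnj c * (a * cnj a' + b * cnj b'))"
    using X by (intro add_left_mono mult_left_mono) simp_all
  finally have rest: "0 \<le> \<dots>" .
  have "(t\<^sup>2 / 4) * (V\<^sup>2 + W\<^sup>2) \<ge> 0" "(3/4) * (cmod (a * b' - a' * b + t *\<^sub>R c'))\<^sup>2 \<ge> 0"
    by simp_all
  with rest show ?thesis
    unfolding sectional7_flat_horizontal sq h h_def[symmetric] Z_def[symmetric] W_def[symmetric]
    by linarith
qed

lemma sectional7_nonpos:
  assumes "u \<bullet> u = 1" "v \<bullet> v = 1" "u \<bullet> v = 0"
  shows "lie7.riem (1/2) (1/2) u v v \<bullet> u \<le> 0"
proof -
  obtain a b c t a' b' c' t' where uv: "u = (a, b, c, t)" "v = (a', b', c', t')"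
    by (cases u, cases v) auto
  txt \<open>Sectional curvature only depends on the plane, so the basis may be rotated until its second
    vector has no \<open>H\<close>-component.\<close>
  obtain r s :: real where rs: "r\<^sup>2 + s\<^sup>2 = 1" "r * t' = s * t"
  proof (cases "t\<^sup>2 + t'\<^sup>2 = 0")
    case True
    then show thesis
      using that[of 1 0] by (simp add: sum_power2_eq_zero_iff)
  next
    case False
    then have pos: "t\<^sup>2 + t'\<^sup>2 > 0"
      by (metis not_sum_power2_lt_zero linorder_neqE_linordered_idom)
    then have "t\<^sup>2 / (t\<^sup>2 + t'\<^sup>2) + t'\<^sup>2 / (t\<^sup>2 + t'\<^sup>2) = 1"
      unfolding add_divide_distrib[symmetric] by (intro divide_self) linarith
    with pos show thesis
      \<comment> \<open>The rotation takes its coefficients from the normalised pair of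
        \<open>H\<close>-components.\<close>
      by (intro that[of "t / sqrt (t\<^sup>2 + t'\<^sup>2)" "t' / sqrt (t\<^sup>2 + t'\<^sup>2)"])
        (auto simp: power_divide)
  qed
  define x y where "x = r *\<^sub>R u + s *\<^sub>R v" and "y = r *\<^sub>R v - s *\<^sub>R u"
  have orth: "x \<bullet> y = 0"
    using assms by (simp add: x_def y_def inner_add_left inner_diff_left inner_add_right inner_diff_right
        inner_commute)
  obtain a1 b1 c1 t1 a2 b2 c2 t2 where xy: "x = (a1, b1, c1, t1)" "y = (a2, b2, c2, t2)"
    by (cases x, cases y) auto
  have "t2 = r * t' - s * t"
    using xy(2) unfolding y_def uv by simp
  then have t2: "t2 = 0"
    using rs(2) by simp
  have "lie7.riem (1/2) (1/2) x y y \<bullet> x \<le> 0"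
    using sectional7_nonpos_horizontal[of a1 a2 b1 b2 c1 c2 t1] orth unfolding xy t2
    by (simp add: add.assoc)
  then show ?thesis
    using lie7.sectional_rotate[OF rs(1)] by (simp add: x_def y_def)
qed

section \<open>The hypersurface groups\<close>

lemmas scaleR_complex = scaleR_conv_of_real[where 'a = complex]

text \<open>Contains every group and Lie algebra element below and is closed under products, so that
  matrix identities reduce to identities in six coordinates.\<close>

definition ut :: "real \<Rightarrow> real \<Rightarrow> real \<Rightarrow> complex \<Rightarrow> complex \<Rightarrow> complex \<Rightarrow> cmat" where
  "ut d1 d2 d3 x y z = diag3 d1 d2 d3 + cscale x (E 1 2) + cscale y (E 2 3) + cscale z (E 1 3)"

lemma ut_nth:
  "ut d1 d2 d3 x y z $ 1 $ 1 = of_real d1" "ut d1 d2 d3 x y z $ 2 $ 2 = of_real d2"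
  "ut d1 d2 d3 x y z $ 3 $ 3 = of_real d3" "ut d1 d2 d3 x y z $ 1 $ 2 = x"
  "ut d1 d2 d3 x y z $ 2 $ 3 = y" "ut d1 d2 d3 x y z $ 1 $ 3 = z"
  "ut d1 d2 d3 x y z $ 2 $ 1 = 0" "ut d1 d2 d3 x y z $ 3 $ 1 = 0" "ut d1 d2 d3 x y z $ 3 $ 2 = 0"
  by (simp_all add: ut_def diag3_def cscale_def E_def scaleR_complex)

lemma cmat_eq_iff:
  fixes A B :: cmat
  shows "A = B \<longleftrightarrow> A $ 1 $ 1 = B $ 1 $ 1 \<and> A $ 1 $ 2 = B $ 1 $ 2 \<and> A $ 1 $ 3 = B $ 1 $ 3 \<and>
    A $ 2 $ 1 = B $ 2 $ 1 \<and> A $ 2 $ 2 = B $ 2 $ 2 \<and> A $ 2 $ 3 = B $ 2 $ 3 \<and>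
    A $ 3 $ 1 = B $ 3 $ 1 \<and> A $ 3 $ 2 = B $ 3 $ 2 \<and> A $ 3 $ 3 = B $ 3 $ 3"
  by (auto simp: vec_eq_iff forall_3)

lemma ut_eq_iff:
  "ut d1 d2 d3 x y z = ut e1 e2 e3 x' y' z' \<longleftrightarrow>
    d1 = e1 \<and> d2 = e2 \<and> d3 = e3 \<and> x = x' \<and> y = y' \<and> z = z'"
  by (auto simp: cmat_eq_iff ut_nth)

lemma cmat_mult_nth: "((A :: cmat) ** B) $ i $ j = A $ i $ 1 * B $ 1 $ j + A $ i $ 2 * B $ 2 $ j + A $ i $ 3 * B $ 3 $ j"
  by (simp add: matrix_matrix_mult_def sum_3)

lemma ut_mult:
  "ut d1 d2 d3 x y z ** ut e1 e2 e3 x' y' z' =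
    ut (d1 * e1) (d2 * e2) (d3 * e3) (d1 *\<^sub>R x' + e2 *\<^sub>R x) (d2 *\<^sub>R y' + e3 *\<^sub>R y)
      (d1 *\<^sub>R z' + x * y' + e3 *\<^sub>R z)"
  by (simp add: cmat_eq_iff ut_nth cmat_mult_nth scaleR_complex)

lemma ut_one: "ut 1 1 1 0 0 0 = mat 1"
  by (simp add: cmat_eq_iff ut_nth mat_def)

lemma ut_add:
  "ut d1 d2 d3 x y z + ut e1 e2 e3 x' y' z' = ut (d1 + e1) (d2 + e2) (d3 + e3) (x + x') (y + y') (z + z')"
  by (simp add: cmat_eq_iff ut_nth)

lemma ut_diff:
  "ut d1 d2 d3 x y z - ut e1 e2 e3 x' y' z' = ut (d1 - e1) (d2 - e2) (d3 - e3) (x - x') (y - y') (z - z')"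
  by (simp add: cmat_eq_iff ut_nth)

lemma ut_scaleR: "r *\<^sub>R ut d1 d2 d3 x y z = ut (r * d1) (r * d2) (r * d3) (r *\<^sub>R x) (r *\<^sub>R y) (r *\<^sub>R z)"
  by (simp add: cmat_eq_iff ut_nth scaleR_complex)

lemma det_ut: "det (ut d1 d2 d3 x y z) = of_real (d1 * d2 * d3)"
  by (simp add: det_3 ut_nth)

text \<open>\<open>V\<close> is the adjugate, and the determinant is 1.\<close>

lemma ut_inverse:
  fixes x y z :: complex
  assumes "d1 * d2 * d3 = 1"
  defines "V \<equiv> ut (d2 * d3) (d1 * d3) (d1 * d2) (- d3 *\<^sub>R x) (- d1 *\<^sub>R y) (x * y - d2 *\<^sub>R z)"
  shows "ut d1 d2 d3 x y z ** V = mat 1" and "V ** ut d1 d2 d3 x y z = mat 1"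
proof -
  have "d1 * (d2 * d3) = 1" "d2 * (d1 * d3) = 1" "d3 * (d1 * d2) = 1"
    using assms(1) by (simp_all add: mult_ac)
  then show "ut d1 d2 d3 x y z ** V = mat 1" "V ** ut d1 d2 d3 x y z = mat 1"
    unfolding V_def ut_mult ut_one[symmetric] ut_eq_iff
    by (simp_all add: mult_ac scaleR_complex algebra_simps)
qed

lemma matrix_inv_eqI:
  fixes A B :: "'a::field^'n^'n"
  assumes "A ** B = mat 1" "B ** A = mat 1"
  shows "matrix_inv A = B"
proof -
  have "A ** matrix_inv A = mat 1 \<and> matrix_inv A ** A = mat 1"
    unfolding matrix_inv_def by (rule someI[of _ B]) (use assms in simp)
  then show ?thesis
    by (metis assms(2) matrix_mul_assoc matrix_mul_lid matrix_mul_rid)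
qed

lemma carrier_SL: "A \<in> carrier SL \<longleftrightarrow> det A = 1"
  and mult_SL: "A \<otimes>\<^bsub>SL\<^esub> B = A ** B"
  and one_SL: "\<one>\<^bsub>SL\<^esub> = mat 1"
  by (simp_all add: SL_def)

lemma group_SL: "group (SL :: (complex^'n^'n) monoid)"
proof (rule groupI)
  fix A :: "complex^'n^'n"
  assume "A \<in> carrier SL"
  then have det: "det A = 1"
    by (simp add: carrier_SL)
  then obtain B where B: "A ** B = mat 1" "B ** A = mat 1"
    by (metis invertible_def invertible_det_nz zero_neq_one)
  then have "det B = 1"
    using det det_mul[of B A] by simp
  then show "\<exists>B\<in>carrier SL. B \<otimes>\<^bsub>SL\<^esub> A = \<one>\<^bsub>SL\<^esub>"
    using B by (auto simp: carrier_SL mult_SL one_SL)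
qed (auto simp: carrier_SL mult_SL one_SL det_mul matrix_mul_assoc)

lemma inv_SL_ut:
  assumes "d1 * d2 * d3 = 1"
  shows "inv\<^bsub>SL\<^esub> (ut d1 d2 d3 x y z) =
    ut (d2 * d3) (d1 * d3) (d1 * d2) (- d3 *\<^sub>R x) (- d1 *\<^sub>R y) (x * y - d2 *\<^sub>R z)"
proof (rule group.inv_equality[OF group_SL])
  have "d2 * d3 * (d1 * d3) * (d1 * d2) = (d1 * d2 * d3) * (d1 * d2 * d3)"
    by (simp add: mult_ac)
  then show "ut (d2 * d3) (d1 * d3) (d1 * d2) (- d3 *\<^sub>R x) (- d1 *\<^sub>R y) (x * y - d2 *\<^sub>R z) \<in> carrier SL"
    by (simp only: carrier_SL det_ut assms) simp
qed (use assms ut_inverse in \<open>simp_all add: mult_SL one_SL carrier_SL det_ut flip: of_real_mult\<close>)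

section \<open>Exponentials and the group \<open>N\<close>\<close>

lemma mexp_nilpotent: "mexp (ut 0 0 0 x y z) = ut 1 1 1 x y (z + x * y / 2)"
proof -
  have pow2: "mpow (ut 0 0 0 x y z) (Suc (Suc 0)) = ut 0 0 0 0 0 (x * y)"
    by (simp add: ut_one[symmetric] ut_mult)
  have pow3: "mpow (ut 0 0 0 x y z) (k + 3) = 0" for k
    by (induction k) (simp_all add: numeral_3_eq_3 ut_one[symmetric] ut_mult,
        simp_all add: cmat_eq_iff ut_nth)
  have "mpow (ut 0 0 0 x y z) k = 0" if "k \<notin> {0, 1, 2}" for k
    using pow3[of "k - 3"] that by (cases "k \<ge> 3") auto
  \<comment> \<open>Nilpotency cuts the series after the square, whose half contributes
    \<open>x * y / 2\<close>.\<close>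
  then have "mexp (ut 0 0 0 x y z) = (\<Sum>k\<in>{0, 1, 2}. (1 / fact k) *\<^sub>R mpow (ut 0 0 0 x y z) k)"
    unfolding mexp_def by (intro suminf_finite) simp_all
  also have "\<dots> = ut 1 1 1 x y (z + x * y / 2)"
    using pow2 by (simp add: numeral_2_eq_2 ut_one[symmetric] ut_mult ut_add ut_scaleR scaleR_complex)
  finally show ?thesis .
qed

lemma mexp_diag: "mexp (ut a b c 0 0 0) = ut (exp a) (exp b) (exp c) 0 0 0"
proof -
  have "mpow (ut a b c 0 0 0) k = ut (a ^ k) (b ^ k) (c ^ k) 0 0 0" for k
    by (induction k) (simp_all add: ut_one ut_mult)
  moreover have "(\<lambda>k. (1 / fact k) *\<^sub>R ut (a ^ k) (b ^ k) (c ^ k) 0 0 0) sums ut (exp a) (exp b) (exp c) 0 0 0"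
  proof -
    have "(\<lambda>k. (x ^ k /\<^sub>R fact k) *\<^sub>R M) sums (exp x *\<^sub>R M)" for x :: real and M :: cmat
      by (intro bounded_linear.sums[OF bounded_linear_scaleR_left] exp_converges)
    from sums_add[OF sums_add[OF this[of a "ut 1 0 0 0 0 0"] this[of b "ut 0 1 0 0 0 0"]]
        this[of c "ut 0 0 1 0 0 0"]]
    show ?thesis
      by (simp add: ut_scaleR ut_add field_simps)
  qed
  ultimately show ?thesis
    by (simp add: mexp_def sums_unique[symmetric])
qed

lemma nil_alg_eq: "nil_alg = {ut 0 0 0 x y z | x y z. True}"
  by (simp add: nil_alg_def ut_def diag3_def)

lemma subgroup_unipotent: "subgroup {ut 1 1 1 x y z | x y z. True} SL"
proof (rule group.subgroupI[OF group_SL])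
  fix a assume "a \<in> {ut 1 1 1 x y z | x y z. True}"
  then show "inv\<^bsub>SL\<^esub> a \<in> {ut 1 1 1 x y z | x y z. True}"
    by (auto simp: inv_SL_ut ut_eq_iff)
qed (auto simp: carrier_SL det_ut mult_SL ut_mult ut_eq_iff)

lemma N_grp_eq: "N_grp = {ut 1 1 1 x y z | x y z. True}"
proof
  show "N_grp \<subseteq> {ut 1 1 1 x y z | x y z. True}"
    unfolding N_grp_def by (intro group.generate_subgroup_incl[OF group_SL]
        subgroup_unipotent)
      (auto simp: nil_alg_eq mexp_nilpotent ut_eq_iff)
  show "{ut 1 1 1 x y z | x y z. True} \<subseteq> N_grp"
  proof safe
    fix x y z
    \<comment> \<open>The exponential is already onto: subtracting \<open>x * y / 2\<close>
      beforehand undoes its quadratic term.\<close>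
    have "ut 1 1 1 x y z = mexp (ut 0 0 0 x y (z - x * y / 2))"
      by (simp add: mexp_nilpotent)
    then show "ut 1 1 1 x y z \<in> N_grp"
      unfolding N_grp_def nil_alg_eq by (intro generate.incl) blast
  qed
qed

section \<open>The direction \<open>H\<close> and the groups \<open>S_H\<close> in
  coordinates\<close>

definition h1 :: "real \<Rightarrow> real" where "h1 \<alpha> = cos \<alpha> / 2 + sin \<alpha> / (2 * sqrt 3)"
definition h2 :: "real \<Rightarrow> real" where "h2 \<alpha> = - sin \<alpha> / sqrt 3"
definition h3 :: "real \<Rightarrow> real" where "h3 \<alpha> = - cos \<alpha> / 2 + sin \<alpha> / (2 * sqrt 3)"

lemma H_dir_eq: "H_dir \<alpha> = ut (h1 \<alpha>) (h2 \<alpha>) (h3 \<alpha>) 0 0 0"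
  by (simp add: cmat_eq_iff ut_nth H_dir_def H0_def H1_def diag3_def E_def h1_def h2_def h3_def
      scaleR_complex)

lemma h_sum: "h1 \<alpha> + h2 \<alpha> + h3 \<alpha> = 0"
  by (simp add: h1_def h2_def h3_def field_simps)

text \<open>\<open>H\<close> is a unit vector, and the metric carries a factor 2 on the
  diagonal.\<close>

lemma h_norm: "(h1 \<alpha>)\<^sup>2 + (h2 \<alpha>)\<^sup>2 + (h3 \<alpha>)\<^sup>2 = 1/2"
  by (simp add: h1_def h2_def h3_def power2_sum power2_diff power_divide power_mult_distrib field_simps
      sin_squared_eq)

text \<open>Differences of diagonal entries are the eigenvalues of ad H on the lines of
  \<open>V\<close> and \<open>W\<close>.\<close>

lemma h_diff: "h1 \<alpha> - h2 \<alpha> = cos (\<alpha> - pi/3)" "h2 \<alpha> - h3 \<alpha> = cos (\<alpha> + pi/3)"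
proof -
  have *: "sin \<alpha> / (2 * sqrt 3) = sqrt 3 / 6 * sin \<alpha>" "sin \<alpha> / sqrt 3 = sqrt 3 / 3 * sin \<alpha>"
    by (simp_all add: field_simps)
  show "h1 \<alpha> - h2 \<alpha> = cos (\<alpha> - pi/3)" "h2 \<alpha> - h3 \<alpha> = cos (\<alpha> + pi/3)"
    by (simp_all add: h1_def h2_def h3_def * cos_diff cos_add cos_60 sin_60 algebra_simps)
qed

definition sh :: "real \<Rightarrow> real \<Rightarrow> complex \<Rightarrow> complex \<Rightarrow> complex \<Rightarrow> cmat" where
  "sh \<alpha> t x y z = ut (exp (t * h1 \<alpha>)) (exp (t * h2 \<alpha>)) (exp (t * h3 \<alpha>)) x y z"

lemma sh_det: "exp (t * h1 \<alpha>) * exp (t * h2 \<alpha>) * exp (t * h3 \<alpha>) = 1"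
  using h_sum[of \<alpha>] by (simp flip: exp_add distrib_left)

lemma S_H_eq: "S_H \<alpha> = {sh \<alpha> t x y z | t x y z. True}"
proof -
  have exp_H: "mexp (t *\<^sub>R H_dir \<alpha>) = sh \<alpha> t 0 0 0" for t
    by (simp add: H_dir_eq ut_scaleR mexp_diag sh_def)
  show ?thesis
  proof (intro equalityI subsetI)
    fix A assume "A \<in> S_H \<alpha>"
    then show "A \<in> {sh \<alpha> t x y z | t x y z. True}"
      by (auto simp: S_H_def set_mult_def N_grp_eq exp_H mult_SL sh_def ut_mult) blast
  next
    fix A assume "A \<in> {sh \<alpha> t x y z | t x y z. True}"
    then obtain t x y z where A: "A = sh \<alpha> t x y z"
      by blast
    \<comment> \<open>A diagonal factor on the right scales columns, so each entry is divided by the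
      diagonal entry of its column.\<close>
    have "A = ut 1 1 1 (x /\<^sub>R exp (t * h2 \<alpha>)) (y /\<^sub>R exp (t * h3 \<alpha>)) (z /\<^sub>R exp (t * h3 \<alpha>))
        ** mexp (t *\<^sub>R H_dir \<alpha>)"
      unfolding exp_H by (simp add: A sh_def ut_mult)
    then show "A \<in> S_H \<alpha>"
      unfolding S_H_def set_mult_def N_grp_eq mult_SL by blast
  qed
qed

lemma sh_in_S_H: "sh \<alpha> t x y z \<in> S_H \<alpha>"
  by (auto simp: S_H_eq)

lemma S_HE:
  assumes "A \<in> S_H \<alpha>"
  obtains t x y z where "A = sh \<alpha> t x y z"
  using assms by (auto simp: S_H_eq)

lemma sh_one: "sh \<alpha> 0 0 0 0 = mat 1"
  by (simp add: sh_def ut_one)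

lemma sh_mult:
  "sh \<alpha> t x y z ** sh \<alpha> s x' y' z' = sh \<alpha> (t + s)
     (exp (t * h1 \<alpha>) *\<^sub>R x' + exp (s * h2 \<alpha>) *\<^sub>R x) (exp (t * h2 \<alpha>) *\<^sub>R y' + exp (s * h3 \<alpha>) *\<^sub>R y)
     (exp (t * h1 \<alpha>) *\<^sub>R z' + x * y' + exp (s * h3 \<alpha>) *\<^sub>R z)"
  by (simp add: sh_def ut_mult exp_add distrib_right)

lemma subgroup_S_H: "subgroup (S_H \<alpha>) SL"
proof (rule group.subgroupI[OF group_SL])
  show "S_H \<alpha> \<subseteq> carrier SL"
    by (auto simp: S_H_eq carrier_SL sh_def det_ut sh_det simp del: of_real_mult)
  show "S_H \<alpha> \<noteq> {}"
    using sh_in_S_H by blast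
  show "A \<otimes>\<^bsub>SL\<^esub> B \<in> S_H \<alpha>" if "A \<in> S_H \<alpha>" "B \<in> S_H \<alpha>" for A B
    using that by (auto elim!: S_HE simp: mult_SL sh_mult sh_in_S_H)
  show "inv\<^bsub>SL\<^esub> A \<in> S_H \<alpha>" if A_in: "A \<in> S_H \<alpha>" for A
  proof -
    obtain t x y z where A: "A = sh \<alpha> t x y z"
      using A_in by (rule S_HE)
    have "sh \<alpha> (-t) (- exp (t * h3 \<alpha>) *\<^sub>R x) (- exp (t * h1 \<alpha>) *\<^sub>R y) (x * y - exp (t * h2 \<alpha>) *\<^sub>R z)
        = inv\<^bsub>SL\<^esub> A"
    proof -
      have eqs: "t * h2 \<alpha> + t * h3 \<alpha> = - (t * h1 \<alpha>)" "t * h1 \<alpha> + t * h3 \<alpha> = - (t * h2 \<alpha>)"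
        "t * h1 \<alpha> + t * h2 \<alpha> = - (t * h3 \<alpha>)"
        using h_sum[of \<alpha>] by algebra+
      show ?thesis
        unfolding A sh_def inv_SL_ut[OF sh_det] exp_add[symmetric] eqs by simp
    qed
    then show ?thesis
      using sh_in_S_H by metis
  qed
qed

section \<open>The invariant frame of \<open>S_H\<close>\<close>

definition frame :: "real \<Rightarrow> lie7 \<Rightarrow> cmat" where
  "frame \<alpha> = (\<lambda>(a, b, c, t).
     cscale a (E 1 2) + cscale b (E 2 3) + cscale c (E 1 3) + t *\<^sub>R H_dir \<alpha>)"

abbreviation brk :: "real \<Rightarrow> lie7 \<Rightarrow> lie7 \<Rightarrow> lie7" where
  "brk \<alpha> \<equiv> bracket7 (cos (\<alpha> - pi/3)) (cos (\<alpha> + pi/3))"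

abbreviation cnx :: "real \<Rightarrow> lie7 \<Rightarrow> lie7 \<Rightarrow> lie7" where
  "cnx \<alpha> \<equiv> connection7 (cos (\<alpha> - pi/3)) (cos (\<alpha> + pi/3))"

lemma frame_eq: "frame \<alpha> (a, b, c, t) = ut (t * h1 \<alpha>) (t * h2 \<alpha>) (t * h3 \<alpha>) a b c"
  by (simp add: frame_def H_dir_eq cmat_eq_iff ut_nth cscale_def E_def scaleR_complex)

lemma linear_frame: "linear (frame \<alpha>)"
  by (auto intro!: linearI simp: frame_eq ut_add ut_scaleR ut_eq_iff algebra_simps)

text \<open>The inner product of tH with the unit vector \<open>H\<close>. It extracts
  \<open>t\<close> from the diagonal without dividing by an entry of \<open>H\<close> that may
  vanish.\<close>

lemma h_recover: "2 * (h1 \<alpha> * (t * h1 \<alpha>) + h2 \<alpha> * (t * h2 \<alpha>) + h3 \<alpha> * (t * h3 \<alpha>)) = t"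
  using h_norm[of \<alpha>] by algebra

lemma inj_frame: "inj (frame \<alpha>)"
proof (rule injI)
  fix u v assume "frame \<alpha> u = frame \<alpha> v"
  moreover obtain a b c t where u: "u = (a, b, c, t)" by (cases u) auto
  moreover obtain a' b' c' t' where v: "v = (a', b', c', t')" by (cases v) auto
  ultimately have eqs: "t * h1 \<alpha> = t' * h1 \<alpha>" "t * h2 \<alpha> = t' * h2 \<alpha>" "t * h3 \<alpha> = t' * h3 \<alpha>"
    and "a = a'" "b = b'" "c = c'"
    by (auto simp: frame_eq ut_eq_iff)
  moreover have "t = t'"
    using h_recover[of \<alpha> t] unfolding eqs(1-3) h_recover by (rule sym)
  ultimately show "u = v"
    by (simp add: u v)
qed

lemma inner_s_ut:
  "inner_s (ut d1 d2 d3 x y z) (ut e1 e2 e3 x' y' z') =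
    x \<bullet> x' + y \<bullet> y' + z \<bullet> z' + 2 * (d1 * e1 + d2 * e2 + d3 * e3)"
proof -
  have "diag_part (ut d1 d2 d3 x y z) = ut d1 d2 d3 0 0 0" for d1 d2 d3 x y z
    by (simp add: cmat_eq_iff ut_nth diag_part_def)
  then show ?thesis
    by (simp add: inner_s_def ut_diff trace_def sum_3 cmat_mult_nth ctranspose_def ut_nth inner_complex_def)
qed

lemma inner_s_frame: "inner_s (frame \<alpha> u) (frame \<alpha> v) = u \<bullet> v"
proof -
  obtain a b c t a' b' c' t' where uv: "u = (a, b, c, t)" "v = (a', b', c', t')"
    by (cases u, cases v) auto
  have "2 * (t * h1 \<alpha> * (t' * h1 \<alpha>) + t * h2 \<alpha> * (t' * h2 \<alpha>) + t * h3 \<alpha> * (t' * h3 \<alpha>)) = t * t'"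
    using h_norm[of \<alpha>] by algebra
  then show ?thesis
    by (simp add: uv frame_eq inner_s_ut)
qed

lemma frame_bracket: "frame \<alpha> (brk \<alpha> u v) = commutator (frame \<alpha> u) (frame \<alpha> v)"
  by (cases u, cases v) (simp add: bracket7_def h_diff[symmetric] frame_eq commutator_def ut_mult ut_diff
      ut_eq_iff algebra_simps)

lemma matrix_inv_sh:
  "matrix_inv (sh \<alpha> t x y z) =
    ut (exp (t * h2 \<alpha>) * exp (t * h3 \<alpha>)) (exp (t * h1 \<alpha>) * exp (t * h3 \<alpha>)) (exp (t * h1 \<alpha>) * exp (t * h2 \<alpha>))
      (- exp (t * h3 \<alpha>) *\<^sub>R x) (- exp (t * h1 \<alpha>) *\<^sub>R y) (x * y - exp (t * h2 \<alpha>) *\<^sub>R z)"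
  unfolding sh_def using ut_inverse[OF sh_det] by (rule matrix_inv_eqI)

lemma S_H_inverse:
  assumes "p \<in> S_H \<alpha>"
  shows "matrix_inv p ** p = mat 1"
proof -
  obtain t x y z where p: "p = sh \<alpha> t x y z"
    using assms by (rule S_HE)
  show ?thesis
    unfolding p matrix_inv_sh unfolding sh_def by (rule ut_inverse[OF sh_det])
qed

lemma bounded_linear_entry: "bounded_linear (\<lambda>q :: cmat. q $ i $ j)"
  by (intro bounded_linear_compose[OF bounded_linear_vec_nth] bounded_linear_vec_nth)

lemma bounded_linear_cscale: "bounded_linear (\<lambda>c. cscale c A)"
  by (simp add: linear_conv_bounded_linear[symmetric])
    (auto intro!: linearI simp: cscale_def vec_eq_iff algebra_simps)

text \<open>On the group the inverse is the adjugate, which is polynomial in the entries and hence a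
  smooth extension to all matrices.\<close>

lemma smooth_within_matrix_inv: "smooth_within (S_H \<alpha>) matrix_inv"
proof -
  note entry = smooth_within_linear[OF bounded_linear_entry]
  note mult = smooth_within_bilinear[OF bounded_bilinear_mult]
  let ?F = "\<lambda>q :: cmat. cscale (q$2$2 * q$3$3) (E 1 1) + cscale (q$1$1 * q$3$3) (E 2 2)
      + cscale (q$1$1 * q$2$2) (E 3 3) + cscale (q$1$2 * q$3$3) (- E 1 2) + cscale (q$1$1 * q$2$3) (- E 2 3)
      + cscale (q$1$2 * q$2$3) (E 1 3) + cscale (q$1$3 * q$2$2) (- E 1 3)"
  have "smooth_within (S_H \<alpha>) ?F"
    by (intro smooth_within_add smooth_within_compose_linear[OF bounded_linear_cscale] mult entry)
  then show ?thesis
  proof (rule smooth_within_cong)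
    fix q assume "q \<in> S_H \<alpha>"
    then obtain t x y z where q: "q = sh \<alpha> t x y z"
      by (rule S_HE)
    show "?F q = matrix_inv q"
      unfolding q matrix_inv_sh
      by (simp add: sh_def cmat_eq_iff ut_nth cscale_def E_def scaleR_complex)
  qed
qed

section \<open>Tangent spaces of \<open>S_H\<close>\<close>

lemma tangent_vanish:
  assumes "has_deriv_along M f p D" "\<And>x. x \<in> M \<Longrightarrow> f x = 0" "v \<in> tangent_space M p"
  shows "D v = 0"
proof -
  have "has_deriv_along M (\<lambda>x. 0) p D"
    by (rule has_deriv_along_cong[OF assms(1,2)])
  then show ?thesis
    using deriv_along_eq[OF _ assms(3)] has_deriv_along_const by metis
qed

text \<open>Functions vanishing on the group have derivatives vanishing on tangent vectors. The
  lower entries, the imaginary parts of the diagonal and the relations among its logarithms leave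
  exactly seven real parameters.\<close>

lemma tangent_space_S_H_subset:
  assumes v: "v \<in> tangent_space (S_H \<alpha>) (sh \<alpha> t x y z)"
  shows "\<exists>u. v = sh \<alpha> t x y z ** frame \<alpha> u"
proof -
  define e1 e2 e3 where "e1 = exp (t * h1 \<alpha>)" and "e2 = exp (t * h2 \<alpha>)" and "e3 = exp (t * h3 \<alpha>)"
  have pos: "e1 > 0" "e2 > 0" "e3 > 0"
    by (simp_all add: e1_def e2_def e3_def)
  have lin: "L v = 0" if "bounded_linear L" "\<And>q. q \<in> S_H \<alpha> \<Longrightarrow> L q = 0" for L :: "cmat \<Rightarrow> complex"
    using tangent_vanish[OF has_deriv_along_linear[OF that(1)] that(2) v] .
  have lower: "v $ 2 $ 1 = 0" "v $ 3 $ 1 = 0" "v $ 3 $ 2 = 0"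
    by (rule lin[OF bounded_linear_entry]; auto elim!: S_HE simp: sh_def ut_nth)+
  have real_diag: "Im (v $ i $ i) = 0" for i
  proof -
    have "bounded_linear (\<lambda>q :: cmat. Im (q $ i $ i))"
      by (intro bounded_linear_compose[OF bounded_linear_Im] bounded_linear_entry)
    moreover have "Im (q $ i $ i) = 0" if "q \<in> S_H \<alpha>" for q
      using that exhaust_3[of i] by (auto elim!: S_HE simp: sh_def ut_nth)
    ultimately show ?thesis
      using tangent_vanish[OF has_deriv_along_linear _ v] by blast
  qed
  txt \<open>On the group the logarithms of the diagonal entries are proportional to \<open>h1\<close>, \<open>h2\<close>, \<open>h3\<close>, so
    their differentials are proportional on tangent vectors.\<close>
  have proportional: "k j * (Re (v $ i $ i) / e i) = k i * (Re (v $ j $ j) / e j)"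
    if e: "\<And>l. e l > 0" and p: "\<And>l. sh \<alpha> t x y z $ l $ l = of_real (e l)"
      and k: "\<And>l t x y z. sh \<alpha> t x y z $ l $ l = of_real (exp (t * k l))" for k e :: "3 \<Rightarrow> real" and i j
  proof -
    let ?f = "\<lambda>q :: cmat. k j * ln (Re (q $ i $ i)) - k i * ln (Re (q $ j $ j))"
    have "has_deriv_along (S_H \<alpha>) ?f (sh \<alpha> t x y z)
        (\<lambda>w. k j * (Re (w $ i $ i) / e i) - k i * (Re (w $ j $ j) / e j))"
      unfolding has_deriv_along_def
    proof (intro exI[of _ UNIV] exI[of _ ?f] conjI ballI refl)
      have entry: "((\<lambda>q :: cmat. Re (q $ l $ l)) has_derivative (\<lambda>w. Re (w $ l $ l))) F" for l F
        by (intro bounded_linear_imp_has_derivative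
            bounded_linear_compose[OF bounded_linear_Re bounded_linear_entry])
      have "((\<lambda>q. ln (Re (q $ l $ l))) has_derivative (\<lambda>w. Re (w $ l $ l) / e l))
          (at (sh \<alpha> t x y z))" for l
        using has_derivative_ln[OF _ entry[of l], of "sh \<alpha> t x y z"] by (simp add: p e divide_inverse)
      then show "(?f has_derivative (\<lambda>w. k j * (Re (w $ i $ i) / e i) - k i * (Re (w $ j $ j) / e j)))
          (at (sh \<alpha> t x y z))"
        by (intro has_derivative_diff has_derivative_mult_right)
    qed auto
    moreover have "?f q = 0" if "q \<in> S_H \<alpha>" for q
      using that by (auto elim!: S_HE simp: k)
    ultimately show ?thesis
      using tangent_vanish[OF _ _ v] by fastforce
  qed
  define k where "k = (\<lambda>l :: 3. if l = 1 then h1 \<alpha> else if l = 2 then h2 \<alpha> else h3 \<alpha>)"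
  have k: "sh \<alpha> t x y z $ l $ l = of_real (exp (t * k l))" for l t x y z
    using exhaust_3[of l] by (auto simp: k_def sh_def ut_nth)
  have ratio: "k j * (Re (v $ i $ i) / exp (t * k i)) = k i * (Re (v $ j $ j) / exp (t * k j))" for i j
    by (rule proportional[OF _ k k]) simp
  define d1 d2 d3 where "d1 = Re (v $ 1 $ 1) / e1" and "d2 = Re (v $ 2 $ 2) / e2" and "d3 = Re (v $ 3 $ 3) / e3"
  have "h2 \<alpha> * d1 = h1 \<alpha> * d2" "h3 \<alpha> * d1 = h1 \<alpha> * d3" "h3 \<alpha> * d2 = h2 \<alpha> * d3"
    using ratio[of 2 1] ratio[of 3 1] ratio[of 3 2]
    by (simp_all add: k_def d1_def d2_def d3_def e1_def e2_def e3_def)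
  \<comment> \<open>The common factor of proportionality, obtained by pairing with the unit vector
    \<open>H\<close>.\<close>
  moreover define s where "s = 2 * (h1 \<alpha> * d1 + h2 \<alpha> * d2 + h3 \<alpha> * d3)"
  ultimately have "s * h1 \<alpha> = d1" "s * h2 \<alpha> = d2" "s * h3 \<alpha> = d3"
    using h_norm[of \<alpha>] by algebra+
  then have diag: "e1 * (s * h1 \<alpha>) = Re (v $ 1 $ 1)" "e2 * (s * h2 \<alpha>) = Re (v $ 2 $ 2)"
      "e3 * (s * h3 \<alpha>) = Re (v $ 3 $ 3)"
    using pos by (simp_all add: d1_def d2_def d3_def)
  \<comment> \<open>Solved from the entries of the product; \<open>b\<close> comes before
    \<open>c\<close> because the corner entry contains \<open>x * b\<close>.\<close>
  define a where "a = (v $ 1 $ 2 - (s * h2 \<alpha>) *\<^sub>R x) /\<^sub>R e1"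
  define b where "b = (v $ 2 $ 3 - (s * h3 \<alpha>) *\<^sub>R y) /\<^sub>R e2"
  define c where "c = (v $ 1 $ 3 - x * b - (s * h3 \<alpha>) *\<^sub>R z) /\<^sub>R e1"
  have "v = ut e1 e2 e3 x y z ** ut (s * h1 \<alpha>) (s * h2 \<alpha>) (s * h3 \<alpha>) a b c"
    unfolding ut_mult diag using pos lower real_diag
    by (simp add: cmat_eq_iff ut_nth complex_eq_iff[of "v $ _ $ _"] a_def b_def c_def)
  then show ?thesis
    using frame_eq[of \<alpha> a b c s] unfolding e1_def e2_def e3_def sh_def[symmetric] by metis
qed

lemma tangent_space_S_H_supset:
  assumes "p \<in> S_H \<alpha>"
  shows "p ** frame \<alpha> u \<in> tangent_space (S_H \<alpha>) p"
proof -
  obtain a b c \<tau> where u: "u = (a, b, c, \<tau>)"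
    by (cases u) auto
  obtain t x y z where p: "p = sh \<alpha> t x y z"
    using assms by (rule S_HE)
  \<comment> \<open>Exponential on the diagonal and linear above it: not a one-parameter subgroup in
    general, but a curve in the group with the right velocity and evident smoothness.\<close>
  define \<gamma>0 where "\<gamma>0 s = exp ((\<tau> * h1 \<alpha>) * s) *\<^sub>R ut 1 0 0 0 0 0 + exp ((\<tau> * h2 \<alpha>) * s) *\<^sub>R ut 0 1 0 0 0 0
      + exp ((\<tau> * h3 \<alpha>) * s) *\<^sub>R ut 0 0 1 0 0 0 + s *\<^sub>R ut 0 0 0 a b c" for s
  have lin: "bounded_linear ((**) p)"
    by (rule bounded_bilinear.bounded_linear_right[OF bounded_bilinear_matrix_mult])
  have \<gamma>0: "\<gamma>0 s = sh \<alpha> (s * \<tau>) (s *\<^sub>R a) (s *\<^sub>R b) (s *\<^sub>R c)" for s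
    by (simp add: \<gamma>0_def sh_def ut_scaleR ut_add mult_ac)
  have "(\<gamma>0 has_vector_derivative (\<tau> * h1 \<alpha>) *\<^sub>R ut 1 0 0 0 0 0 + (\<tau> * h2 \<alpha>) *\<^sub>R ut 0 1 0 0 0 0
      + (\<tau> * h3 \<alpha>) *\<^sub>R ut 0 0 1 0 0 0 + ut 0 0 0 a b c) (at 0)"
    unfolding \<gamma>0_def[abs_def] has_vector_derivative_def
    by (auto intro!: derivative_eq_intros simp: algebra_simps)
  then have "(\<gamma>0 has_vector_derivative ut (\<tau> * h1 \<alpha>) (\<tau> * h2 \<alpha>) (\<tau> * h3 \<alpha>) a b c) (at 0)"
    by (simp add: ut_scaleR ut_add)
  then have "((\<lambda>s. p ** \<gamma>0 s) has_vector_derivative p ** frame \<alpha> u) (at 0)"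
    unfolding u frame_eq by (rule bounded_linear.has_vector_derivative[OF lin])
  moreover have "smooth_on {-1<..<1} (\<lambda>s. p ** \<gamma>0 s)"
    unfolding \<gamma>0_def
    by (intro smooth_on_compose_linear[OF lin] smooth_on_add smooth_on_exp_scaleR
        smooth_on_linear bounded_linear_scaleR_left open_greaterThanLessThan)
  moreover have "p ** \<gamma>0 s \<in> S_H \<alpha>" for s
    unfolding p \<gamma>0 sh_mult by (rule sh_in_S_H)
  moreover have "p ** \<gamma>0 0 = p"
    by (simp add: \<gamma>0 sh_one)
  ultimately have "curve_in (S_H \<alpha>) p (p ** frame \<alpha> u) (\<lambda>s. p ** \<gamma>0 s)"
    unfolding curve_in_def by (intro conjI exI[of _ 1]) auto
  then show ?thesis
    unfolding tangent_space_def by blast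
qed

interpretation S_H: left_invariant_geometry "brk \<alpha>" "cnx \<alpha>" "S_H \<alpha>" metric_S "frame \<alpha>" for \<alpha>
proof (intro left_invariant_geometry.intro left_invariant_geometry_axioms.intro linear_frame inj_frame
    frame_bracket smooth_within_matrix_inv lie7.metric_lie_algebra_axioms)
  fix p u v assume p: "p \<in> S_H \<alpha>"
  show "matrix_inv p ** p = mat 1"
    by (rule S_H_inverse[OF p])
  then have "matrix_inv p ** (p ** A) = A" for A :: cmat
    by (simp add: matrix_mul_assoc)
  then show "metric_S p (p ** frame \<alpha> u) (p ** frame \<alpha> v) = u \<bullet> v"
    by (simp add: metric_S_def inner_s_frame)
  obtain t x y z where "p = sh \<alpha> t x y z"
    using p by (rule S_HE)
  then show "tangent_space (S_H \<alpha>) p = range (\<lambda>v. p ** frame \<alpha> v)"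
    using tangent_space_S_H_subset tangent_space_S_H_supset[OF p] by blast
qed

section \<open>Curvature of the hypersurfaces\<close>

lemma one_in_S_H: "mat 1 \<in> S_H \<alpha>"
  using sh_in_S_H[of \<alpha> 0 0 0 0] by (simp add: sh_one)

lemma frame_in_tangent_one: "frame \<alpha> u \<in> tangent_space (S_H \<alpha>) (mat 1)"
  using S_H.tangentI[OF one_in_S_H, of \<alpha> u] by simp

section \<open>Trigonometry of the eigenvalues\<close>

lemma cos_shift_sum: "cos (\<alpha> - pi/3) + cos (\<alpha> + pi/3) = cos \<alpha>"
  by (simp add: cos_diff cos_add cos_60)

text \<open>The doubled angles are spaced by 2\<pi>/3 around the circle, so their cosines cancel.
  Consequently the Ricci curvature of \<open>H\<close> is -3 for every \<alpha>.\<close>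

lemma cos_sq_sum: "(cos (\<alpha> - pi/3))\<^sup>2 + (cos (\<alpha> + pi/3))\<^sup>2 + (cos \<alpha>)\<^sup>2 = 3/2"
  unfolding cos_diff cos_add cos_60 sin_60
  by (simp add: power2_sum power2_diff power_mult_distrib power_divide sin_squared_eq)
    (simp add: field_simps)

lemma cos_shift_pos:
  assumes "\<alpha> \<in> {0..pi/2}"
  shows "cos (\<alpha> - pi/3) > 0"
  by (rule cos_gt_zero_pi) (use assms pi_gt_zero in \<open>unfold atLeastAtMost_iff, linarith+\<close>)

text \<open>Trades the products of cosines in the Ricci form for the products of sines in the stated
  formula.\<close>

lemma cos_sin_shift:
  "cos \<alpha> * cos (\<alpha> - pi/3) + sin \<alpha> * sin (\<alpha> - pi/3) = 1/2"
  "cos \<alpha> * cos (\<alpha> + pi/3) + sin \<alpha> * sin (\<alpha> + pi/3) = 1/2"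
  using cos_diff[of \<alpha> "\<alpha> - pi/3"] cos_diff[of \<alpha> "\<alpha> + pi/3"] by (simp_all add: cos_60)

section \<open>Ricci curvature\<close>

lemma ricci_S_H:
  assumes "p \<in> S_H \<alpha>"
  shows "ricci (S_H \<alpha>) metric_S p (p ** frame \<alpha> (a, b, c, t)) =
    - (1 + 4 * cos \<alpha> * cos (\<alpha> - pi/3)) * (cmod a)\<^sup>2 - (1 + 4 * cos \<alpha> * cos (\<alpha> + pi/3)) * (cmod b)\<^sup>2
    + (1 - 4 * (cos \<alpha>)\<^sup>2) * (cmod c)\<^sup>2 - 3 * t\<^sup>2"
  unfolding S_H.ricci_eq[OF assms] ricci7 using cos_sq_sum[of \<alpha>] by (simp add: cos_shift_sum)

lemma ricci_formula:
  assumes "p \<in> S_H \<alpha>"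
  shows "ricci (S_H \<alpha>) metric_S p (p ** frame \<alpha> (a, b, c, t)) =
    - 3 * ((cmod a)\<^sup>2 + (cmod b)\<^sup>2 + (cmod c)\<^sup>2 + t\<^sup>2)
    + 4 * sin \<alpha> * (sin (\<alpha> - pi/3) * (cmod a)\<^sup>2 + sin (\<alpha> + pi/3) * (cmod b)\<^sup>2 + sin \<alpha> * (cmod c)\<^sup>2)"
  unfolding ricci_S_H[OF assms] using cos_sin_shift[of \<alpha>] sin_cos_squared_add[of \<alpha>] by algebra

text \<open>This direction decides all regimes: its Ricci curvature changes sign at \<pi>/3, while
  that of \<open>W\<close> merely touches zero there and that of \<open>V\<close> stays
  negative.\<close>

lemma ricci_center: "ricci (S_H \<alpha>) metric_S (mat 1) (frame \<alpha> (0, 0, 1, 0)) = 1 - 4 * (cos \<alpha>)\<^sup>2"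
  using ricci_S_H[OF one_in_S_H, of \<alpha> 0 0 1 0] by simp

lemma frame_nonzero: "u \<noteq> 0 \<Longrightarrow> frame \<alpha> u \<noteq> 0"
  using inj_frame[of \<alpha>] linear_0[OF linear_frame[of \<alpha>]] by (metis injD)

lemma cos_ge_half_iff:
  assumes "\<alpha> \<in> {0..pi/2}"
  shows "1/2 < cos \<alpha> \<longleftrightarrow> \<alpha> < pi/3"
  using cos_mono_less_eq[of "pi/3" \<alpha>] assms by (simp add: cos_60)

lemma strictly_negative_ricci_iff:
  assumes \<alpha>: "\<alpha> \<in> {0..pi/2}"
  shows "strictly_negative_ricci (S_H \<alpha>) metric_S \<longleftrightarrow> \<alpha> < pi/3"
proof
  assume "strictly_negative_ricci (S_H \<alpha>) metric_S"
  then have "1 - 4 * (cos \<alpha>)\<^sup>2 < 0"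
    using one_in_S_H frame_in_tangent_one frame_nonzero[of "(0, 0, 1, 0)"] ricci_center[of \<alpha>]
    unfolding strictly_negative_ricci_def by (fastforce simp: zero_prod_def)
  moreover have "cos \<alpha> \<ge> 0"
    using \<alpha> by (intro cos_ge_zero) auto
  ultimately have "1/2 < cos \<alpha>"
    by (intro power2_less_imp_less[of "1/2"]) (simp_all add: power_divide)
  then show "\<alpha> < pi/3"
    using cos_ge_half_iff[OF \<alpha>] by simp
next
  assume lt: "\<alpha> < pi/3"
  have pos: "cos \<alpha> > 0" "cos (\<alpha> - pi/3) > 0"
    using cos_shift_pos[OF \<alpha>] cos_ge_half_iff[OF \<alpha>] lt by auto
  have A: "1 + 4 * cos \<alpha> * cos (\<alpha> - pi/3) > 0"
    using mult_pos_pos[OF pos] by linarith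
  have B: "1 + 4 * cos \<alpha> * cos (\<alpha> + pi/3) > 0"
  proof -
    \<comment> \<open>The coefficient equals \<open>2 + 2 * cos (2 * \<alpha> + pi/3)\<close>, and
      its angle stays below \<pi> exactly for \<alpha> < \<pi>/3.\<close>
    have "cos pi < cos (2 * \<alpha> + pi/3)"
      using \<alpha> lt by (intro cos_monotone_0_pi) auto
    moreover have "2 * cos \<alpha> * cos (\<alpha> + pi/3) = cos (2 * \<alpha> + pi/3) + 1/2"
      using cos_add[of \<alpha> "\<alpha> + pi/3"] cos_diff[of "\<alpha> + pi/3" \<alpha>] by (simp add: cos_60 mult.commute)
    ultimately show ?thesis
      by simp
  qed
  have C: "1 - 4 * (cos \<alpha>)\<^sup>2 < 0"
    using power_strict_mono[of "1/2" "cos \<alpha>" 2] cos_ge_half_iff[OF \<alpha>] lt by (simp add: power_divide)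
  show "strictly_negative_ricci (S_H \<alpha>) metric_S"
    unfolding strictly_negative_ricci_def
  proof (intro ballI impI)
    fix p X assume p: "p \<in> S_H \<alpha>" and tX: "X \<in> tangent_space (S_H \<alpha>) p" and X: "X \<noteq> 0"
    obtain u where u: "X = p ** frame \<alpha> u"
      by (rule S_H.tangentE[OF p tX])
    obtain a b c t where u': "u = (a, b, c, t)"
      by (cases u) auto
    have "u \<noteq> 0"
      using X u linear_0[OF linear_frame] by (auto simp: matrix_mult_bilinear_simps)
    then have "a \<noteq> 0 \<or> b \<noteq> 0 \<or> c \<noteq> 0 \<or> t \<noteq> 0"
      by (auto simp: u' zero_prod_def)
    moreover have "0 \<le> (1 + 4 * cos \<alpha> * cos (\<alpha> - pi/3)) * (cmod a)\<^sup>2"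
      "0 \<le> (1 + 4 * cos \<alpha> * cos (\<alpha> + pi/3)) * (cmod b)\<^sup>2" "(1 - 4 * (cos \<alpha>)\<^sup>2) * (cmod c)\<^sup>2 \<le> 0" "0 \<le> t\<^sup>2"
      using A B C by (auto intro: mult_nonneg_nonneg mult_nonpos_nonneg)
    moreover have "a \<noteq> 0 \<Longrightarrow> 0 < (1 + 4 * cos \<alpha> * cos (\<alpha> - pi/3)) * (cmod a)\<^sup>2"
      "b \<noteq> 0 \<Longrightarrow> 0 < (1 + 4 * cos \<alpha> * cos (\<alpha> + pi/3)) * (cmod b)\<^sup>2"
      "c \<noteq> 0 \<Longrightarrow> (1 - 4 * (cos \<alpha>)\<^sup>2) * (cmod c)\<^sup>2 < 0" "t \<noteq> 0 \<Longrightarrow> 0 < t\<^sup>2"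
      using A B C by (auto intro: mult_pos_pos mult_neg_pos)
    ultimately show "ricci (S_H \<alpha>) metric_S p X < 0"
      unfolding u u' ricci_S_H[OF p] by linarith
  qed
qed

lemma metric_one: "metric_S (mat 1) (frame \<alpha> u) (frame \<alpha> v) = u \<bullet> v"
  using S_H.metric_eq[OF one_in_S_H, of \<alpha> u v] by simp

lemma einstein_iff:
  assumes \<alpha>: "\<alpha> \<in> {0..pi/2}"
  shows "einstein (S_H \<alpha>) metric_S \<longleftrightarrow> \<alpha> = 0"
proof
  assume "einstein (S_H \<alpha>) metric_S"
  then obtain k where k: "\<And>p X. p \<in> S_H \<alpha> \<Longrightarrow> X \<in> tangent_space (S_H \<alpha>) p \<Longrightarrow>
      ricci (S_H \<alpha>) metric_S p X = k * metric_S p X X"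
    unfolding einstein_def by blast
  \<comment> \<open>The directions of \<open>H\<close> and \<open>Z\<^sub>0\<close> suffice: equal
    Ricci curvatures there force the square of the cosine to be 1.\<close>
  have "k = - 3"
    using k[OF one_in_S_H frame_in_tangent_one, of "(0, 0, 0, 1)"]
      ricci_S_H[OF one_in_S_H, of \<alpha> 0 0 0 1] by (simp add: metric_one)
  moreover have "k = 1 - 4 * (cos \<alpha>)\<^sup>2"
    using k[OF one_in_S_H frame_in_tangent_one, of "(0, 0, 1, 0)"]
      ricci_center[of \<alpha>] by (simp add: metric_one inner_complex_def)
  ultimately have "(cos \<alpha>)\<^sup>2 = 1"
    by simp
  then have "sin \<alpha> = 0"
    using sin_cos_squared_add[of \<alpha>] by simp
  then show "\<alpha> = 0"
    using \<alpha> sin_gt_zero[of \<alpha>] pi_gt_zero by (cases "\<alpha> = 0") (auto simp: field_simps)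
next
  assume 0: "\<alpha> = 0"
  show "einstein (S_H \<alpha>) metric_S"
    unfolding einstein_def
  proof (intro exI[of _ "-3"] ballI)
    fix p X assume p: "p \<in> S_H \<alpha>" and "X \<in> tangent_space (S_H \<alpha>) p"
    then obtain u where u: "X = p ** frame \<alpha> u"
      by (rule S_H.tangentE)
    obtain a b c t where u': "u = (a, b, c, t)"
      by (cases u) auto
    show "ricci (S_H \<alpha>) metric_S p X = - 3 * metric_S p X X"
      unfolding u S_H.metric_eq[OF p] unfolding u' ricci_formula[OF p] cmod_power2
      by (simp add: 0 inner_complex_def power2_eq_square)
  qed
qed

section \<open>Sectional curvature\<close>

lemma ex_positive_plane:
  assumes "\<alpha> \<in> {0<..pi/2}"
  shows "\<exists>X Y. orthonormal_pair (S_H \<alpha>) metric_S (mat 1) X Y \<and> sectional (S_H \<alpha>) metric_S (mat 1) X Y > 0"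
proof -
  \<comment> \<open>Each vector has three entries of modulus \<open>r\<close>, so this value
    normalises both.\<close>
  define r :: real where "r = 1 / sqrt 3"
  have r: "r\<^sup>2 = 1/3"
    by (simp add: r_def power_divide)
  define x y :: lie7 where "x = (of_real r, of_real r, of_real r * \<i>, 0)"
    and "y = (of_real r * \<i>, of_real r * \<i>, of_real r, 0)"
  have "x \<bullet> x = 1" "y \<bullet> y = 1" "x \<bullet> y = 0"
    using r by (simp_all add: x_def y_def inner_complex_def power2_eq_square)
  then have "orthonormal_pair (S_H \<alpha>) metric_S (mat 1) (frame \<alpha> x) (frame \<alpha> y)"
    using S_H.orthonormal_pair_iff[OF one_in_S_H, of \<alpha> x y] by simp
  moreover have "sectional (S_H \<alpha>) metric_S (mat 1) (frame \<alpha> x) (frame \<alpha> y) = 4/9 * (sin \<alpha>)\<^sup>2"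
  proof -
    have "r ^ 4 = (r\<^sup>2)\<^sup>2"
      by (simp flip: power_mult)
    then have r4: "r ^ 4 = 1/9"
      by (simp add: r power_divide)
    show ?thesis
      using S_H.sectional_eq[OF one_in_S_H, of \<alpha> x y]
        sectional7_positive[of "cos (\<alpha> - pi/3)" "cos (\<alpha> + pi/3)" r]
      by (simp add: x_def y_def cos_shift_sum sin_squared_eq r4)
  qed
  moreover have "sin \<alpha> > 0"
    using assms pi_gt_zero by (intro sin_gt_zero) auto
  ultimately show ?thesis
    by (metis mult_pos_pos zero_less_divide_iff zero_less_numeral zero_less_power)
qed

text \<open>\<open>V\<close> is used because its eigenvalue is positive on the whole interval,
  whereas that of \<open>W\<close> vanishes at \<pi>/6 and that of \<open>Z\<^sub>0\<close> at
  \<pi>/2.\<close>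

lemma ex_negative_plane:
  assumes "\<alpha> \<in> {0..pi/2}"
  shows "\<exists>X Y. orthonormal_pair (S_H \<alpha>) metric_S (mat 1) X Y \<and> sectional (S_H \<alpha>) metric_S (mat 1) X Y < 0"
proof -
  let ?x = "(1, 0, 0, 0) :: lie7" and ?y = "(0, 0, 0, 1) :: lie7"
  have "orthonormal_pair (S_H \<alpha>) metric_S (mat 1) (frame \<alpha> ?x) (frame \<alpha> ?y)"
    using S_H.orthonormal_pair_iff[OF one_in_S_H, of \<alpha> ?x ?y] by simp
  moreover have "sectional (S_H \<alpha>) metric_S (mat 1) (frame \<alpha> ?x) (frame \<alpha> ?y) = - (cos (\<alpha> - pi/3))\<^sup>2"
    using S_H.sectional_eq[OF one_in_S_H, of \<alpha> ?x ?y] by (simp add: sectional7_negative)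
  moreover have "cos (\<alpha> - pi/3) > 0"
    by (rule cos_shift_pos[OF assms])
  ultimately show ?thesis
    by (metis neg_less_0_iff_less zero_less_power)
qed

lemma nonpositively_curved_0: "nonpositively_curved (S_H 0) metric_S"
  unfolding nonpositively_curved_def
proof (intro ballI allI impI)
  fix p X Y assume p: "p \<in> S_H 0" and XY: "orthonormal_pair (S_H 0) metric_S p X Y"
  obtain u where u: "X = p ** frame 0 u"
    using S_H.tangentE[OF p] XY unfolding orthonormal_pair_def by blast
  obtain v where v: "Y = p ** frame 0 v"
    using S_H.tangentE[OF p] XY unfolding orthonormal_pair_def by blast
  have "sectional (S_H 0) metric_S p X Y = lie7.riem (1/2) (1/2) u v v \<bullet> u"
    unfolding u v S_H.sectional_eq[OF p] by (simp add: cos_60)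
  moreover have "u \<bullet> u = 1" "v \<bullet> v = 1" "u \<bullet> v = 0"
    using XY unfolding u v S_H.orthonormal_pair_iff[OF p] by auto
  ultimately show "sectional (S_H 0) metric_S p X Y \<le> 0"
    using sectional7_nonpos by simp
qed

section \<open>The Damek-Ricci space\<close>

lemma closed_S_H_0: "closed (S_H 0)"
proof -
  have h: "h1 0 = 1/2" "h2 0 = 0" "h3 0 = - 1/2"
    by (simp_all add: h1_def h2_def h3_def)
  \<comment> \<open>The diagonal is exp (t/2), 1, exp (-t/2). The product condition excludes zero,
    so the weak inequality describes positivity by a closed condition.\<close>
  have "S_H 0 = {M. M$2$1 = 0 \<and> M$3$1 = 0 \<and> M$3$2 = 0 \<and> M$2$2 = 1 \<and> Im (M$1$1) = 0 \<and> Im (M$3$3) = 0 \<and>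
      0 \<le> Re (M$1$1) \<and> Re (M$1$1) * Re (M$3$3) = 1}"
    (is "_ = ?C")
  proof (intro equalityI subsetI)
    fix M assume "M \<in> S_H 0"
    then show "M \<in> ?C"
      by (auto elim!: S_HE simp: sh_def ut_nth h simp flip: exp_add)
  next
    fix M assume M: "M \<in> ?C"
    then have "Re (M$1$1) \<noteq> 0"
      by auto
    then have pos: "Re (M$1$1) > 0"
      using M by auto
    have "Re (M$3$3) = inverse (Re (M$1$1))"
      using M pos by (auto simp: field_simps)
    then have "M = sh 0 (2 * ln (Re (M$1$1))) (M$1$2) (M$2$3) (M$1$3)"
      using M pos by (simp add: cmat_eq_iff sh_def ut_nth h complex_eq_iff exp_minus)
        (simp add: power2_eq_square field_simps)
    then show "M \<in> S_H 0"
      using sh_in_S_H by metis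
  qed
  also have "closed \<dots>"
    by (intro closed_Collect_conj closed_Collect_eq closed_Collect_le continuous_intros)
  finally show ?thesis .
qed

text \<open>The coordinates are a global homeomorphism with a vector space; the logarithms of the
  diagonal, paired with \<open>H\<close>, give back \<open>t\<close>.\<close>

lemma simply_connected_S_H: "simply_connected (S_H \<alpha>)"
proof -
  let ?f = "\<lambda>(a, b, c, t). sh \<alpha> t a b c"
  let ?t = "\<lambda>M :: cmat. 2 * (h1 \<alpha> * ln (Re (M$1$1)) + h2 \<alpha> * ln (Re (M$2$2)) + h3 \<alpha> * ln (Re (M$3$3)))"
  let ?g = "\<lambda>M :: cmat. (M$1$2, M$2$3, M$1$3, ?t M) :: lie7"
  have pos: "Re (M $ i $ i) > 0" if "M \<in> S_H \<alpha>" for M i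
    using that exhaust_3[of i] by (auto elim!: S_HE simp: sh_def ut_nth)
  have "homeomorphism (UNIV :: lie7 set) (S_H \<alpha>) ?f ?g"
    unfolding homeomorphism_def
  proof (intro conjI ballI)
    show gf: "?g (?f u) = u" for u
      using h_recover[of \<alpha>] by (cases u) (simp add: sh_def ut_nth)
    show fg: "?f (?g M) = M" if "M \<in> S_H \<alpha>" for M
      using that h_recover[of \<alpha>] by (auto elim!: S_HE simp: sh_def ut_nth)
    show "?f ` UNIV = S_H \<alpha>"
      by (auto simp: S_H_eq image_def)
    show "?g ` S_H \<alpha> = UNIV"
      using gf sh_in_S_H by (metis (no_types, lifting) UNIV_eq_I case_prod_beta imageI)
    show "continuous_on UNIV ?f"
      unfolding sh_def ut_def diag3_def split_beta
      by (intro continuous_intros bounded_linear.continuous_on[OF bounded_linear_cscale])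
    show "continuous_on (S_H \<alpha>) ?g"
      by (intro continuous_intros) (use pos in \<open>fastforce simp: less_imp_neq[symmetric]\<close>)+
  qed
  then have "(UNIV :: lie7 set) homeomorphic S_H \<alpha>"
    unfolding homeomorphic_def by blast
  then show ?thesis
    using homeomorphic_simply_connected convex_imp_simply_connected[OF convex_UNIV] by blast
qed

section \<open>Solvability\<close>

lemma derived_SL_subset:
  fixes T :: "(complex^'n^'n) set"
  assumes "subgroup T SL"
    and "\<And>A B. A \<in> K \<Longrightarrow> B \<in> K \<Longrightarrow> A ** B ** inv\<^bsub>SL\<^esub> A ** inv\<^bsub>SL\<^esub> B \<in> T"
  shows "derived SL K \<subseteq> T"
  unfolding derived_def
  by (rule group.generate_subgroup_incl[OF group_SL _ assms(1)]) (use assms(2) in \<open>auto simp: mult_SL\<close>)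

lemma subgroup_center: "subgroup {ut 1 1 1 0 0 z | z. True} SL"
proof (rule group.subgroupI[OF group_SL])
  fix a assume "a \<in> {ut 1 1 1 0 0 z | z. True}"
  then show "inv\<^bsub>SL\<^esub> a \<in> {ut 1 1 1 0 0 z | z. True}"
    by (auto simp: inv_SL_ut ut_eq_iff)
qed (auto simp: carrier_SL det_ut mult_SL ut_mult ut_eq_iff)

lemma solvable_S_H: "solvable (SL\<lparr>carrier := S_H \<alpha>\<rparr>)"
proof -
  interpret SL: group "SL :: cmat monoid" by (rule group_SL)
  have "derived SL (S_H \<alpha>) \<subseteq> {ut 1 1 1 x y z | x y z. True}"
  proof (rule derived_SL_subset[OF subgroup_unipotent])
    fix A B assume "A \<in> S_H \<alpha>" "B \<in> S_H \<alpha>"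
    then obtain t x y z s x' y' z' where AB: "A = sh \<alpha> t x y z" "B = sh \<alpha> s x' y' z'"
      by (metis S_HE)
    \<comment> \<open>The diagonal of a group commutator, with inverses written as adjugates:
      diagonal parts commute, so it is 1.\<close>
    have "d1 * e1 * (d2 * d3) * (e2 * e3) = 1" "d2 * e2 * (d1 * d3) * (e1 * e3) = 1"
      "d3 * e3 * (d1 * d2) * (e1 * e2) = 1"
      if "d1 * d2 * d3 = 1" "e1 * e2 * e3 = 1" for d1 d2 d3 e1 e2 e3 :: real
      using that by algebra+
    from this[OF sh_det sh_det]
    show "A ** B ** inv\<^bsub>SL\<^esub> A ** inv\<^bsub>SL\<^esub> B \<in> {ut 1 1 1 x y z | x y z. True}"
      unfolding AB sh_def inv_SL_ut[OF sh_det] ut_mult by auto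
  qed
  moreover have "derived SL {ut 1 1 1 x y z | x y z. True} \<subseteq> {ut 1 1 1 0 0 z | z. True}"
    by (rule derived_SL_subset[OF subgroup_center])
      (auto simp: inv_SL_ut ut_mult ut_eq_iff)
  moreover have "derived SL {ut 1 1 1 0 0 z | z. True} \<subseteq> {mat 1}"
    by (rule derived_SL_subset)
      (auto simp: inv_SL_ut ut_mult ut_one SL.triv_subgroup[unfolded one_SL])
  ultimately have "derived SL (derived SL (derived SL (S_H \<alpha>))) \<subseteq> {mat 1}"
    by (meson SL.mono_derived order_trans)
  moreover have "mat 1 \<in> derived SL K" for K :: "cmat set"
    unfolding derived_def using generate.one[of SL] by (simp add: one_SL)
  ultimately have "(derived SL ^^ 3) (S_H \<alpha>) = {\<one>\<^bsub>SL\<^esub>}"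
    unfolding numeral_3_eq_3 by (simp add: one_SL subset_antisym)
  then have seq: "solvable_seq SL (S_H \<alpha>)"
    by (rule SL.trivial_derived_seq_imp_solvable[OF subgroup_S_H])
  interpret S: group "SL\<lparr>carrier := S_H \<alpha>\<rparr>"
    by (rule subgroup.subgroup_is_group[OF subgroup_S_H group_SL])
  \<comment> \<open>The derived series was computed inside \<open>SL\<close>; solvability passes to
    the subgroup as a group of its own along the injective inclusion.\<close>
  interpret incl: group_hom "SL\<lparr>carrier := S_H \<alpha>\<rparr>" SL id
    by unfold_locales (use subgroup.subset[OF subgroup_S_H[of \<alpha>]] in \<open>auto simp: hom_def\<close>)
  show ?thesis
    unfolding solvable_def
    using incl.solvable_img_imp_solvable[OF S.subgroup_self] seq by simp
qed

section \<open>The metric and the Damek-Ricci structure\<close>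

lemma left_invariant_metric_S: "left_invariant_metric (S_H \<alpha>) metric_S"
  unfolding left_invariant_metric_def
proof (intro conjI ballI allI impI)
  fix p q u v assume p: "p \<in> S_H \<alpha>" and q: "q \<in> S_H \<alpha>"
    and u: "u \<in> tangent_space (S_H \<alpha>) p" and v: "v \<in> tangent_space (S_H \<alpha>) p"
  obtain a where a: "u = p ** frame \<alpha> a"
    by (rule S_H.tangentE[OF p u])
  obtain b where b: "v = p ** frame \<alpha> b"
    by (rule S_H.tangentE[OF p v])
  have "q ** p \<in> S_H \<alpha>"
    using subgroup.m_closed[OF subgroup_S_H q p] by (simp add: mult_SL)
  then show "metric_S (q ** p) (q ** u) (q ** v) = metric_S p u v"
    unfolding a b by (simp add: S_H.metric_eq[OF p] S_H.metric_eq matrix_mul_assoc)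
next
  fix u v w assume "u \<in> tangent_space (S_H \<alpha>) (mat 1)" "v \<in> tangent_space (S_H \<alpha>) (mat 1)"
    "w \<in> tangent_space (S_H \<alpha>) (mat 1)"
  then obtain a b c where abc: "u = frame \<alpha> a" "v = frame \<alpha> b" "w = frame \<alpha> c"
    by (metis S_H.tangentE matrix_mul_lid one_in_S_H)
  note lin = linear_add[OF linear_frame, symmetric] linear_scale[OF linear_frame, symmetric]
  show "metric_S (mat 1) u v = metric_S (mat 1) v u"
    by (simp add: abc metric_one inner_commute)
  show "metric_S (mat 1) (u + w) v = metric_S (mat 1) u v + metric_S (mat 1) w v"
    by (simp add: abc metric_one lin inner_add_left)
  show "metric_S (mat 1) (r *\<^sub>R u) v = r * metric_S (mat 1) u v" for r
    by (simp add: abc metric_one lin)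
  show "metric_S (mat 1) u u > 0" if "u \<noteq> 0"
    using that linear_0[OF linear_frame] by (auto simp: abc metric_one)
qed

lemma damek_ricci_0: "damek_ricci (S_H 0) metric_S"
proof -
  have h: "h1 0 = 1/2" "h2 0 = 0" "h3 0 = - 1/2"
    by (simp_all add: h1_def h2_def h3_def)
  define V Z :: "cmat set" where "V = {ut 0 0 0 a b 0 | a b. True}" and "Z = {ut 0 0 0 0 0 c | c. True}"
  define A0 where "A0 = ut (1/2) 0 (-1/2) 0 0 0"
  \<comment> \<open>Solves the duality: moving \<open>a\<close> and \<open>b\<close> across the real
    inner product of \<open>c\<close> with \<open>a * b' - a' * b\<close> conjugates them. Applying
    the map twice gives minus the squared modulus of \<open>c\<close>.\<close>
  define J where "J Y U = ut 0 0 0 (- (Y$1$3) * cnj (U$2$3)) (Y$1$3 * cnj (U$1$2)) 0" for Y U :: cmat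
  have g: "metric_S (mat 1) (ut d1 d2 d3 x y z) (ut e1 e2 e3 x' y' z')
      = x \<bullet> x' + y \<bullet> y' + z \<bullet> z' + 2 * (d1 * e1 + d2 * e2 + d3 * e3)"
    for d1 d2 d3 x y z e1 e2 e3 x' y' z'
    using matrix_inv_eqI[of "mat 1 :: cmat" "mat 1"] by (simp add: metric_S_def inner_s_ut)
  have tan: "tangent_space (S_H 0) (mat 1) = {U + Y + r *\<^sub>R A0 | U Y r. U \<in> V \<and> Y \<in> Z}"
  proof -
    have "tangent_space (S_H 0) (mat 1) = range (frame 0)"
      using S_H.tangent_space_eq[OF one_in_S_H, of 0] by simp
    also have "\<dots> = {ut 0 0 0 a b 0 + ut 0 0 0 0 0 c + r *\<^sub>R A0 | a b c r. True}"
      by (auto simp: image_def frame_eq h A0_def ut_add ut_scaleR ut_eq_iff Bex_def)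
    finally show ?thesis
      by (auto simp: V_def Z_def)
  qed
  have sub: "subspace V" "subspace Z"
    unfolding subspace_def V_def Z_def
    by (auto simp: ut_add ut_scaleR ut_eq_iff cmat_eq_iff ut_nth)
  have orth: "\<forall>U\<in>V. \<forall>Y\<in>Z. metric_S (mat 1) U Y = 0" "\<forall>U\<in>V. metric_S (mat 1) U A0 = 0"
    "\<forall>Y\<in>Z. metric_S (mat 1) Y A0 = 0" "metric_S (mat 1) A0 A0 = 1"
    by (auto simp: V_def Z_def A0_def g)
  have zero: "ut 0 0 0 0 0 0 = 0"
    by (simp add: cmat_eq_iff ut_nth)
  note bracket = commutator_def ut_mult ut_diff
  have comm: "\<forall>U\<in>V. \<forall>U'\<in>V. commutator U U' \<in> Z" "\<forall>U\<in>V. \<forall>Y\<in>Z. commutator U Y = 0"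
    "\<forall>Y\<in>Z. \<forall>Y'\<in>Z. commutator Y Y' = 0"
    by (auto simp: V_def Z_def bracket zero)
  have A0: "\<forall>U\<in>V. commutator A0 U = (1/2) *\<^sub>R U" "\<forall>Y\<in>Z. commutator A0 Y = Y"
    by (auto simp: V_def Z_def A0_def bracket ut_scaleR ut_eq_iff scaleR_complex)
  have J: "\<forall>Y\<in>Z. \<forall>U\<in>V. J Y U \<in> V \<and>
      (\<forall>U'\<in>V. metric_S (mat 1) (J Y U) U' = metric_S (mat 1) Y (commutator U U')) \<and>
      J Y (J Y U) = - metric_S (mat 1) Y Y *\<^sub>R U"
  proof (intro ballI conjI)
    fix Y U U' assume YU: "Y \<in> Z" "U \<in> V"
    then obtain a b c where eq: "Y = ut 0 0 0 0 0 c" "U = ut 0 0 0 a b 0"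
      by (auto simp: V_def Z_def)
    show "J Y U \<in> V"
      by (auto simp: J_def V_def)
    show "J Y (J Y U) = - metric_S (mat 1) Y Y *\<^sub>R U"
      unfolding eq J_def g ut_nth ut_scaleR ut_eq_iff
      by (simp add: complex_eq_iff inner_complex_def algebra_simps)
    assume "U' \<in> V"
    then obtain a' b' where eq': "U' = ut 0 0 0 a' b' 0"
      by (auto simp: V_def)
    show "metric_S (mat 1) (J Y U) U' = metric_S (mat 1) Y (commutator U U')"
      unfolding eq eq' J_def bracket g ut_nth by (simp add: inner_complex_def algebra_simps)
  qed
  show ?thesis
    unfolding damek_ricci_def matrix_lie_group_def
    by (intro conjI subgroup_S_H closed_S_H_0 simply_connected_S_H solvable_S_H left_invariant_metric_S,
      rule exI[of _ V], rule exI[of _ Z], rule exI[of _ A0], rule exI[of _ J],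
      intro conjI tan sub orth comm A0 J)
qed

theorem theorem1p3:
  fixes \<alpha> :: real
  assumes "\<alpha> \<in> {0..pi/2}"
  shows
    "(\<forall>(a::complex) (b::complex) (c::complex) (t::real).
        (cmod a)\<^sup>2 + (cmod b)\<^sup>2 + (cmod c)\<^sup>2 + t\<^sup>2 = 1 \<longrightarrow>
        ricci (S_H \<alpha>) metric_S (mat 1)
          (cscale a (E 1 2) + cscale b (E 2 3) + cscale c (E 1 3) + t *\<^sub>R H_dir \<alpha>)
        = -3 + 4 * sin \<alpha> * (sin (\<alpha> - pi/3) * (cmod a)\<^sup>2 + sin (\<alpha> + pi/3) * (cmod b)\<^sup>2
                            + sin \<alpha> * (cmod c)\<^sup>2)) \<and>
     (strictly_negative_ricci (S_H \<alpha>) metric_S \<longleftrightarrow> \<alpha> \<in> {0..<pi/3}) \<and>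
     (\<alpha> = pi/3 \<longrightarrow>
        (\<exists>p\<in>S_H \<alpha>. \<exists>X\<in>tangent_space (S_H \<alpha>) p. X \<noteq> 0 \<and> ricci (S_H \<alpha>) metric_S p X = 0)) \<and>
     (\<alpha> \<in> {pi/3<..pi/2} \<longrightarrow>
        (\<exists>p\<in>S_H \<alpha>. \<exists>X\<in>tangent_space (S_H \<alpha>) p. X \<noteq> 0 \<and> ricci (S_H \<alpha>) metric_S p X > 0)) \<and>
     (einstein (S_H \<alpha>) metric_S \<longleftrightarrow> \<alpha> = 0) \<and>
     (\<alpha> \<in> {0<..pi/2} \<longrightarrow>
        (\<exists>p\<in>S_H \<alpha>. \<exists>X Y. orthonormal_pair (S_H \<alpha>) metric_S p X Y \<and>
                          sectional (S_H \<alpha>) metric_S p X Y > 0) \<and>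
        (\<exists>p\<in>S_H \<alpha>. \<exists>X Y. orthonormal_pair (S_H \<alpha>) metric_S p X Y \<and>
                          sectional (S_H \<alpha>) metric_S p X Y < 0)) \<and>
     (\<alpha> = 0 \<longrightarrow>
        nonpositively_curved (S_H \<alpha>) metric_S \<and> damek_ricci (S_H \<alpha>) metric_S)"
proof (intro conjI allI impI)
  fix a b c :: complex and t :: real
  assume "(cmod a)\<^sup>2 + (cmod b)\<^sup>2 + (cmod c)\<^sup>2 + t\<^sup>2 = 1"
  then show "ricci (S_H \<alpha>) metric_S (mat 1)
          (cscale a (E 1 2) + cscale b (E 2 3) + cscale c (E 1 3) + t *\<^sub>R H_dir \<alpha>)
        = -3 + 4 * sin \<alpha> * (sin (\<alpha> - pi/3) * (cmod a)\<^sup>2 + sin (\<alpha> + pi/3) * (cmod b)\<^sup>2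
                            + sin \<alpha> * (cmod c)\<^sup>2)"
    using ricci_formula[OF one_in_S_H, of \<alpha> a b c t] by (simp add: frame_def)
next
  show "strictly_negative_ricci (S_H \<alpha>) metric_S \<longleftrightarrow> \<alpha> \<in> {0..<pi/3}"
    using strictly_negative_ricci_iff[OF assms] assms by simp
next
  have central: "frame \<alpha> (0, 0, 1, 0) \<noteq> 0"
    by (rule frame_nonzero) (simp add: zero_prod_def)
  assume "\<alpha> = pi/3"
  then have "ricci (S_H \<alpha>) metric_S (mat 1) (frame \<alpha> (0, 0, 1, 0)) = 0"
    by (simp only: ricci_center) (simp add: cos_60 power_divide)
  then show "\<exists>p\<in>S_H \<alpha>. \<exists>X\<in>tangent_space (S_H \<alpha>) p. X \<noteq> 0 \<and> ricci (S_H \<alpha>) metric_S p X = 0"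
    using one_in_S_H frame_in_tangent_one central by blast
next
  have central: "frame \<alpha> (0, 0, 1, 0) \<noteq> 0"
    by (rule frame_nonzero) (simp add: zero_prod_def)
  assume \<alpha>: "\<alpha> \<in> {pi/3<..pi/2}"
  have "cos \<alpha> < cos (pi/3)"
    using \<alpha> pi_gt_zero by (intro cos_monotone_0_pi) auto
  moreover have "cos \<alpha> \<ge> 0"
    using assms by (intro cos_ge_zero) auto
  ultimately have "(cos \<alpha>)\<^sup>2 < (1/2)\<^sup>2"
    by (intro power_strict_mono) (simp_all add: cos_60)
  then have "ricci (S_H \<alpha>) metric_S (mat 1) (frame \<alpha> (0, 0, 1, 0)) > 0"
    unfolding ricci_center by (simp add: power_divide)
  then show "\<exists>p\<in>S_H \<alpha>. \<exists>X\<in>tangent_space (S_H \<alpha>) p. X \<noteq> 0 \<and> ricci (S_H \<alpha>) metric_S p X > 0"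
    using one_in_S_H frame_in_tangent_one central by blast
next
  show "einstein (S_H \<alpha>) metric_S \<longleftrightarrow> \<alpha> = 0"
    by (rule einstein_iff[OF assms])
next
  assume "\<alpha> \<in> {0<..pi/2}"
  then show "\<exists>p\<in>S_H \<alpha>. \<exists>X Y. orthonormal_pair (S_H \<alpha>) metric_S p X Y \<and>
      sectional (S_H \<alpha>) metric_S p X Y > 0"
    using ex_positive_plane one_in_S_H by blast
next
  show "\<exists>p\<in>S_H \<alpha>. \<exists>X Y. orthonormal_pair (S_H \<alpha>) metric_S p X Y \<and>
      sectional (S_H \<alpha>) metric_S p X Y < 0"
    using ex_negative_plane[OF assms] one_in_S_H by blast
next
  assume "\<alpha> = 0"
  then show "nonpositively_curved (S_H \<alpha>) metric_S" "damek_ricci (S_H \<alpha>) metric_S"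
    using nonpositively_curved_0 damek_ricci_0 by simp_all
qed

end
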